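(* Let $m<d$ be positive integers, let $Y$ be an $\mathbb{R}^d$-valued random variable and $\phi:\mathbb{R}^d\to\mathbb{R}$ a measurable function with $\mathrm{E}[\phi^2(Y)]<+\infty$. Let $g_1,\dots,g_m$ be probability densities with respect to the Lebesgue measure on $\mathbb{R}$, $g(x_1,\dots,x_m)=\prod_{k=1}^m g_k(x_k)$, let $\mu$ be a $d\times m$ orthonormal matrix such that $\mu^TY$ has a density $f_\mu$ with respect to the Lebesgue measure $\lambda$ on $\mathbb{R}^m$, and let $\chi$ be a probability density with respect to the Lebesgue measure on $\mathbb{R}^m$. Put $\psi_\mu(x)=\mathrm{E}[\phi(Y)\mid \mu^TY=x]$ and $\zeta_\mu(x)=\mathrm{E}[\phi^2(Y)\mid\mu^TY=x]$. Assume that (A1) $\int_{\mathbb{R}^m}\chi^2/g\,d\lambda<+\infty$ and $\operatorname{ess\,inf}_{g\cdot\lambda}(\chi/g)>0$; (A2) for every $h\in\{f_\mu,\ \zeta_\mu f_\mu,\ \psi_\mu f_\mu\}$, $\int_{\mathbb{R}^m}h^2/g\,d\lambda<+\infty$; (A3) $\int_{\mathbb{R}^m} f_\mu^4(\zeta_\mu-\psi_\mu^2)^2/[\chi^2 g]\,d\lambda<+\infty$. Let $$\varsigma_\infty^2(\mu,\chi)=\int_{\mathbb{R}^m} \frac{f_\mu^2(\zeta_\mu-\psi_\mu^2)}{\chi}\,d\lambda .$$ With $\varsigma^2_{I,M}(\mu,g,\mathcal{Q}_\chi)$ as defined in the context, $$\lim_{I\to+\infty}\ \lim_{M\to+\infty}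 M\,\varsigma^2_{I,M}(\mu,g,\mathcal{Q}_\chi)=\varsigma_\infty^2(\mu,\chi).$$ Assume in addition one of the following conditions: (i) $\operatorname{ess\,sup}_{\chi\cdot\lambda}(f_\mu/\chi)<+\infty$ and $\{I_M,M\ge1\}$ is a sequence of positive integers such that $I_M^{-1}+I_M^m M^{-1}\to0$ as $M\to+\infty$; (ii) $\{I_M,M\ge1\}$ is a sequence of positive integers such that $I_M^{-1}+I_M^{2m}M^{-1}\to0$ as $M\to+\infty$. Then $$\lim_{M\to+\infty}M\,\varsigma^2_{I_M,M}(\mu,g,\mathcal{Q}_\chi)=\varsigma_\infty^2(\mu,\chi).$$
   Context: Conventions: $z/0=+\infty$ if $z>0$ and $z/0=0$ if $z=0$. For a measure $\nu$ on $\mathbb{R}^m$, $\operatorname{ess\,inf}_\nu$ and $\operatorname{ess\,sup}_\nu$ are the essential infimum and supremum with respect to $\nu$; $g\cdot\lambda$ denotes the measure with density $g$ with respect to $\lambda$. A $d\times m$ matrix $\mu$ is orthonormal if $\mu^T\mu$ is the $m\times m$ identity. For a probability density $h$ on $\mathbb{R}$ with cumulative distribution function $H$, the quantile function is $H^{-1}(u)=\inf\{x\in\{H>0\}:H(x)\ge u\}$, $u\in[0,1]$, with $\inf\emptyset=+\infty$. Let $G_k$ be the c.d.f. of $g_k$. For a positive integer $I$ and $\mathbf{i}=(i_1,\dots,i_m)\in\{1,\dots,I\}^m$, the stratum is $$\mathsf{S}_{\mathbf{i}}=\prod_{k=1}^m\Big(G_k^{-1}\big(\tfrac{i_k-1}{I}\big),G_k^{-1}\big(\tfrac{i_k}{I}\big)\Big]\subset\mathbb{R}^m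 .$$ Put $p_{\mathbf{i}}(\mu)=\mathrm{P}(\mu^TY\in\mathsf{S}_{\mathbf{i}})$ and let $\sigma^2_{\mathbf{i}}(\mu)$ be the conditional variance of $\phi(Y)$ given $\mu^TY\in\mathsf{S}_{\mathbf{i}}$ (with $p_{\mathbf{i}}(\mu)\sigma_{\mathbf{i}}(\mu)=0$ if $p_{\mathbf{i}}(\mu)=0$), so that $p_{\mathbf{i}}^2(\mu)\sigma_{\mathbf{i}}^2(\mu)=\big(\int_{\mathsf{S}_{\mathbf{i}}}f_\mu d\lambda\big)\big(\int_{\mathsf{S}_{\mathbf{i}}}\zeta_\mu f_\mu d\lambda\big)-\big(\int_{\mathsf{S}_{\mathbf{i}}}\psi_\mu f_\mu d\lambda\big)^2$. Fix a total order on the index set $\{1,\dots,I\}^m$. For a vector $\mathcal{Q}=\{q_{\mathbf{i}}\}$ of nonnegative weights and a positive integer $M$ (total number of draws), let $$M_{\mathbf{i}}=\Big\lfloor M\sum_{\mathbf{j}\le\mathbf{i}}q_{\mathbf{j}}\Big\rfloor-\Big\lfloor M\sum_{\mathbf{j}<\mathbf{i}}q_{\mathbf{j}}\Big\rfloor$$ (empty sums are $0$) and $$\varsigma^2_{I,M}(\mu,g,\mathcal{Q})=\sum_{\mathbf{i}\in\{1,\dots,I\}^m:\,M_{\mathbf{i}}>0}M_{\mathbf{i}}^{-1}\,p^2_{\mathbf{i}}(\mu)\,\sigma^2_{\mathbf{i}}(\mu).$$ The allocation attached to the density $\chi$ is $\mathcal{Q}_\chi=\{q_{\mathbf{i}}(\chi)=\int_{\mathsf{S}_{\mathbf{i}}}\chi\,d\lambda,\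 \mathbf{i}\in\{1,\dots,I\}^m\}$. *)

theory Defs
  imports "HOL-Probability.Probability"
begin

definition prob_density :: "('a::euclidean_space \<Rightarrow> real) \<Rightarrow> bool" where
  "prob_density h \<longleftrightarrow>
     h \<in> borel_measurable borel \<and> (\<forall>x. 0 \<le> h x) \<and> (\<integral>\<^sup>+ x. ennreal (h x) \<partial>lborel) = 1"

text \<open>
  Quotients of nonnegative reals are taken in \<^typ>\<open>ennreal\<close>, where \<open>z / 0 = \<infinity>\<close> for \<open>z > 0\<close>
  and \<open>0 / 0 = 0\<close>, rather than in \<^typ>\<open>real\<close>, where \<open>z / 0 = 0\<close> throughout.
\<close>

lemma ennreal_div_zero: "z > 0 \<Longrightarrow> (z::ennreal) / 0 = \<infinity>" "(0::ennreal) / 0 = 0"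
  by (simp_all add: divide_ennreal_def ennreal_mult_top)

definition essinf :: "'a measure \<Rightarrow> ('a \<Rightarrow> ennreal) \<Rightarrow> ennreal" where
  "essinf N f = Sup {z. AE x in N. z \<le> f x}"

text \<open>\<open>\<xi>\<close> is a version of \<open>x \<mapsto> E[Z | X = x]\<close>.\<close>

definition is_cond_exp_given ::
  "'a measure \<Rightarrow> ('a \<Rightarrow> 'b::topological_space) \<Rightarrow> ('a \<Rightarrow> real) \<Rightarrow> ('b \<Rightarrow> real) \<Rightarrow> bool" where
  "is_cond_exp_given P X Z \<xi> \<longleftrightarrow>
     \<xi> \<in> borel_measurable borel \<and>
     (AE \<omega> in P. real_cond_exp P (vimage_algebra (space P) X borel) Z \<omega> = \<xi> (X \<omega>))"

definition product_density :: "('m::finite \<Rightarrow> real \<Rightarrow> real) \<Rightarrow> real^'m \<Rightarrow> real" where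
  "product_density gs x = (\<Prod>k\<in>UNIV. gs k (x $ k))"

text \<open>
  The quantile function is \<^typ>\<open>ereal\<close>-valued: the infimum of the empty set is \<open>\<infinity>\<close>, and the
  quantile of order 0 is \<open>-\<infinity>\<close> when the distribution is unbounded below.
\<close>

definition quantile :: "(real \<Rightarrow> real) \<Rightarrow> real \<Rightarrow> ereal" where
  "quantile h u = (let H = cdf (density lborel (\<lambda>x. ennreal (h x)))
                   in Inf (ereal ` {x. H x > 0 \<and> H x \<ge> u}))"

definition strata_indices :: "nat \<Rightarrow> ('m::finite \<Rightarrow> nat) set" where
  "strata_indices I = {i. \<forall>k. i k \<in> {1..I}}"

definition stratum :: "('m::finite \<Rightarrow> real \<Rightarrow> real) \<Rightarrow> nat \<Rightarrow> ('m \<Rightarrow> nat) \<Rightarrow> (real^'m) set" where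
  "stratum gs I i =
     {x. \<forall>k. quantile (gs k) ((real (i k) - 1) / real I) < ereal (x $ k) \<and>
             ereal (x $ k) \<le> quantile (gs k) (real (i k) / real I)}"

text \<open>
  Conditioning on a null event \<open>A\<close> yields the value 0, since \<^term>\<open>uniform_measure P A\<close> is then the
  null measure.
\<close>

definition cond_variance :: "'a measure \<Rightarrow> 'a set \<Rightarrow> ('a \<Rightarrow> real) \<Rightarrow> real" where
  "cond_variance P A Z = prob_space.variance (uniform_measure P A) Z"

definition stratum_event ::
  "'a measure \<Rightarrow> ('a \<Rightarrow> real^'d::finite) \<Rightarrow> real^'m::finite^'d \<Rightarrow> ('m \<Rightarrow> real \<Rightarrow> real)
     \<Rightarrow> nat \<Rightarrow> ('m \<Rightarrow> nat) \<Rightarrow> 'a set" where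
  "stratum_event P Y \<mu> gs I i = {\<omega> \<in> space P. transpose \<mu> *v Y \<omega> \<in> stratum gs I i}"

text \<open>The total order on the index set is given as a relation \<open>r\<close>.\<close>

definition draws ::
  "('m::finite \<Rightarrow> nat) rel \<Rightarrow> nat \<Rightarrow> (('m \<Rightarrow> nat) \<Rightarrow> real) \<Rightarrow> nat \<Rightarrow> ('m \<Rightarrow> nat) \<Rightarrow> int" where
  "draws r I q M i =
     \<lfloor>real M * (\<Sum>j | j \<in> strata_indices I \<and> (j, i) \<in> r. q j)\<rfloor> -
     \<lfloor>real M * (\<Sum>j | j \<in> strata_indices I \<and> (j, i) \<in> r \<and> j \<noteq> i. q j)\<rfloor>"

definition allocation ::
  "('m::finite \<Rightarrow> real \<Rightarrow> real) \<Rightarrow> (real^'m \<Rightarrow> real) \<Rightarrow> nat \<Rightarrow> ('m \<Rightarrow> nat) \<Rightarrow> real" where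
  "allocation gs chi I i = (LINT x:stratum gs I i|lborel. chi x)"

definition strat_variance ::
  "'a measure \<Rightarrow> ('a \<Rightarrow> real^'d::finite) \<Rightarrow> (real^'d \<Rightarrow> real) \<Rightarrow> (nat \<Rightarrow> ('m::finite \<Rightarrow> nat) rel)
     \<Rightarrow> real^'m^'d \<Rightarrow> ('m \<Rightarrow> real \<Rightarrow> real) \<Rightarrow> (nat \<Rightarrow> ('m \<Rightarrow> nat) \<Rightarrow> real) \<Rightarrow> nat \<Rightarrow> nat \<Rightarrow> real" where
  "strat_variance P Y \<phi> r \<mu> gs Q I M =
     (\<Sum>i | i \<in> strata_indices I \<and> draws (r I) I (Q I) M i > 0.
        (measure P (stratum_event P Y \<mu> gs I i))\<^sup>2 *
        cond_variance P (stratum_event P Y \<mu> gs I i) (\<lambda>\<omega>. \<phi> (Y \<omega>)) /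
        real_of_int (draws (r I) I (Q I) M i))"

text \<open>
  The numerator is nonnegative almost everywhere when \<open>\<psi>\<close>, \<open>\<zeta>\<close> are the conditional first and
  second moments and \<open>f\<close> the density of the conditioning variable (Jensen), so the truncation at 0
  by \<^const>\<open>ennreal\<close> is harmless.
\<close>

definition limit_variance ::
  "(real^'m::finite \<Rightarrow> real) \<Rightarrow> (real^'m \<Rightarrow> real) \<Rightarrow> (real^'m \<Rightarrow> real) \<Rightarrow> (real^'m \<Rightarrow> real) \<Rightarrow> ennreal"
  where
  "limit_variance f \<psi> \<zeta> chi =
     (\<integral>\<^sup>+ x. ennreal ((f x)\<^sup>2 * (\<zeta> x - (\<psi> x)\<^sup>2)) / ennreal (chi x) \<partial>lborel)"

end

theory Submission
  imports Defs
begin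

text \<open>
  Put \<open>\<nu> = chi \<cdot> lborel\<close> and \<open>u = f/chi\<close>, \<open>v = \<zeta> f/chi\<close>, \<open>w = \<psi> f/chi\<close>. Since \<open>chi \<ge> c g\<close> for some
  \<open>c > 0\<close>, these functions lie in \<open>L\<^sup>2(\<nu>)\<close>, and proportional allocation with \<open>M \<rightarrow> \<infinity>\<close> gives
  \<open>L I = \<Sum>\<^sub>i (U\<^sub>i V\<^sub>i - W\<^sub>i\<^sup>2) / \<nu>(S\<^sub>i)\<close>, where \<open>U\<^sub>i\<close>, \<open>V\<^sub>i\<close>, \<open>W\<^sub>i\<close> are the integrals of \<open>u\<close>, \<open>v\<close>, \<open>w\<close>
  over the stratum \<open>S\<^sub>i\<close> with respect to \<open>\<nu>\<close>. This is \<open>\<integral> (E u)(E v) - (E w)\<^sup>2 d\<nu>\<close> for the conditional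
  expectation \<open>E\<close> given the strata, which converges strongly to the identity on \<open>L\<^sup>2(\<nu>)\<close> as \<open>I \<rightarrow> \<infinity>\<close>: only
  the strata straddling a coordinate hyperplane matter for the indicator of an orthant \<open>{..a}\<close>, and
  their mass tends to 0 because the law of each marginal rank has no atoms.
  Every stratum has \<open>\<nu>\<close>-mass at least \<open>c / I\<^sup>m\<close> and the number of draws differs from \<open>M \<nu>(S\<^sub>i)\<close> by
  less than 1, so replacing it by \<open>M \<nu>(S\<^sub>i)\<close> costs a relative error \<open>1 / (M c / I\<^sup>m - 1)\<close>, uniformly in
  the stratum; hence \<open>I\<^sup>m / M \<rightarrow> 0\<close> suffices for the joint limit.
\<close>

section \<open>Projections onto finite families of cells\<close>

text \<open>For disjoint cells this is the integral of \<open>E u * E v\<close>, with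
  \<open>E\<close> the orthogonal projection onto the span of the cell indicators. A null cell
  contributes 0, since division by 0 yields 0.\<close>

definition cell_form ::
  "'a measure \<Rightarrow> 'i set \<Rightarrow> ('i \<Rightarrow> 'a set) \<Rightarrow> ('a \<Rightarrow> real) \<Rightarrow> ('a \<Rightarrow> real) \<Rightarrow> real" where
  "cell_form N J S u v =
     (\<Sum>i\<in>J. (LINT x:S i|N. u x) * (LINT x:S i|N. v x) / measure N (S i))"

section \<open>Square-integrable functions\<close>

definition square_integrable :: "'a measure \<Rightarrow> ('a \<Rightarrow> real) \<Rightarrow> bool" where
  "square_integrable N u \<longleftrightarrow> u \<in> borel_measurable N \<and> integrable N (\<lambda>x. (u x)\<^sup>2)"

lemma square_integrable_mult:
  assumes "square_integrable N u" "square_integrable N v"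
  shows "integrable N (\<lambda>x. u x * v x)"
proof (rule Bochner_Integration.integrable_bound)
  show "integrable N (\<lambda>x. (u x)\<^sup>2 + (v x)\<^sup>2)" "(\<lambda>x. u x * v x) \<in> borel_measurable N"
    using assms unfolding square_integrable_def by auto
  have "\<bar>a * b\<bar> \<le> a\<^sup>2 + b\<^sup>2" for a b :: real
  proof -
    have "2 * \<bar>a * b\<bar> \<le> a\<^sup>2 + b\<^sup>2"
      using sum_squares_bound[of "\<bar>a\<bar>" "\<bar>b\<bar>"] by (simp add: abs_mult mult.assoc)
    then show ?thesis using abs_ge_zero[of "a * b"] by linarith
  qed
  then show "AE x in N. norm (u x * v x) \<le> norm ((u x)\<^sup>2 + (v x)\<^sup>2)"
    by auto
qed

lemma square_integrable_add:
  assumes "square_integrable N u" "square_integrable N v"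
  shows "square_integrable N (\<lambda>x. u x + v x)"
proof -
  have "integrable N (\<lambda>x. (u x)\<^sup>2 + (v x)\<^sup>2 + 2 * (u x * v x))"
    using assms square_integrable_mult[OF assms] unfolding square_integrable_def by auto
  then show ?thesis
    using assms unfolding square_integrable_def by (auto simp: power2_sum algebra_simps)
qed

lemma square_integrable_cmult:
  assumes "square_integrable N u"
  shows "square_integrable N (\<lambda>x. c * u x)"
  using assms unfolding square_integrable_def by (auto simp: power_mult_distrib)

lemma square_integrable_diff:
  assumes "square_integrable N u" "square_integrable N v"
  shows "square_integrable N (\<lambda>x. u x - v x)"
  using square_integrable_add[OF assms(1) square_integrable_cmult[OF assms(2), of "-1"]] by simp

lemma square_integrable_bound:
  assumes "square_integrable N u" "v \<in> borel_measurable N" "\<And>x. x \<in> space N \<Longrightarrow> \<bar>v x\<bar> \<le> \<bar>u x\<bar>"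
  shows "square_integrable N v"
  unfolding square_integrable_def
proof
  show "integrable N (\<lambda>x. (v x)\<^sup>2)"
  proof (rule Bochner_Integration.integrable_bound)
    show "integrable N (\<lambda>x. (u x)\<^sup>2)" "(\<lambda>x. (v x)\<^sup>2) \<in> borel_measurable N"
      using assms unfolding square_integrable_def by auto
    show "AE x in N. norm ((v x)\<^sup>2) \<le> norm ((u x)\<^sup>2)"
      using abs_le_square_iff[THEN iffD1, OF assms(3)] by (intro AE_I2) simp
  qed
qed fact

lemma (in finite_measure) square_integrable_const: "square_integrable M (\<lambda>x. c)"
  unfolding square_integrable_def by simp

lemma (in finite_measure) square_integrable_indicator:
  "A \<in> sets M \<Longrightarrow> square_integrable M (indicator A)"
  using square_integrable_bound[OF square_integrable_const[of 1], of "indicator A"]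
  by (auto simp: indicator_def)

lemma (in finite_measure) square_integrable_integrable:
  assumes "square_integrable M u"
  shows "integrable M u"
  using square_integrable_mult[OF assms square_integrable_const[of 1]] by simp

lemma (in finite_measure) square_integrable_set_integrable:
  assumes "square_integrable M u" "A \<in> sets M"
  shows "set_integrable M A u"
  using integrable_mult_indicator[OF assms(2) square_integrable_integrable[OF assms(1)]]
  unfolding set_integrable_def .

text \<open>Cauchy-Schwarz on \<open>A\<close>: expand the nonnegative integral of
  \<open>(u - t)\<^sup>2\<close> over \<open>A\<close>, with \<open>t\<close> the mean of
  \<open>u\<close> on \<open>A\<close>. For a null set the left side is 0 because the quotient
  is.\<close>

lemma (in finite_measure) set_integral_square_le:
  assumes u: "square_integrable M u" and A: "A \<in> sets M"
  shows "(LINT x:A|M. u x)\<^sup>2 / measure M A \<le> (LINT x:A|M. (u x)\<^sup>2)"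
proof (cases "measure M A = 0")
  case True
  then show ?thesis
    by (auto intro!: Bochner_Integration.integral_nonneg simp: set_lebesgue_integral_def)
next
  case False
  define t where "t = (LINT x:A|M. u x) / measure M A"
  have m: "measure M A > 0" using False by (simp add: zero_less_measure_iff)
  have i1: "integrable M (\<lambda>x. indicator A x *\<^sub>R u x)"
    using square_integrable_set_integrable[OF u A] unfolding set_integrable_def .
  have i2: "integrable M (\<lambda>x. indicator A x *\<^sub>R (u x)\<^sup>2)"
    using u A unfolding square_integrable_def by (intro integrable_mult_indicator) auto
  have "0 \<le> (\<integral>x. indicator A x *\<^sub>R (u x - t)\<^sup>2 \<partial>M)"
    by (auto intro!: Bochner_Integration.integral_nonneg)
  also have "(\<lambda>x. indicator A x *\<^sub>R (u x - t)\<^sup>2) =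
      (\<lambda>x. indicator A x *\<^sub>R (u x)\<^sup>2 - 2 * t * (indicator A x *\<^sub>R u x) + t\<^sup>2 * indicator A x)"
    by (auto simp: fun_eq_iff power2_diff algebra_simps)
  also have "(\<integral>x. indicator A x *\<^sub>R (u x)\<^sup>2 - 2 * t * (indicator A x *\<^sub>R u x) + t\<^sup>2 * indicator A x \<partial>M)
     = (LINT x:A|M. (u x)\<^sup>2) - 2 * t * (LINT x:A|M. u x) + t\<^sup>2 * measure M A"
  proof -
    have i3: "integrable M (\<lambda>x. t\<^sup>2 * indicator A x)"
      using A by (intro integrable_mult_right integrable_real_indicator) (auto simp: emeasure_eq_measure)
    have i4: "integrable M (\<lambda>x. 2 * t * (indicator A x *\<^sub>R u x))"
      using i1 by (rule integrable_mult_right)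
    have "(\<integral>x. t\<^sup>2 * indicator A x \<partial>M) = t\<^sup>2 * measure M A"
      using A by simp
    then show ?thesis
      unfolding set_lebesgue_integral_def
        Bochner_Integration.integral_add[OF Bochner_Integration.integrable_diff[OF i2 i4] i3]
        Bochner_Integration.integral_diff[OF i2 i4]
      by simp
  qed
  also have "\<dots> = (LINT x:A|M. (u x)\<^sup>2) - (LINT x:A|M. u x)\<^sup>2 / measure M A"
  proof -
    have "2 * t * (LINT x:A|M. u x) = 2 * ((LINT x:A|M. u x)\<^sup>2 / measure M A)"
      unfolding t_def by (simp add: power2_eq_square)
    moreover have "t\<^sup>2 * measure M A = (LINT x:A|M. u x)\<^sup>2 / measure M A"
      using m unfolding t_def by (simp add: power2_eq_square)
    ultimately show ?thesis by linarith
  qed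
  finally show ?thesis by simp
qed

section \<open>The squared distance to the functions constant on cells\<close>

locale cell_family = prob_space N for N :: "'a measure" +
  fixes J :: "'i set" and S :: "'i \<Rightarrow> 'a set"
  assumes fin: "finite J"
    and cells [measurable]: "\<And>i. i \<in> J \<Longrightarrow> S i \<in> sets N"
    and disj: "disjoint_family_on S J"
begin

text \<open>By Pythagoras this is the squared \<open>L\<^sup>2\<close> distance from
  \<open>u\<close> to the span of the cell indicators. The quadratic form stands in for the
  projection, which is never constructed.\<close>

definition residual :: "('a \<Rightarrow> real) \<Rightarrow> real" where
  "residual u = (\<integral>x. (u x)\<^sup>2 \<partial>N) - cell_form N J S u u"

text \<open>Bessel's inequality: the Cauchy-Schwarz bound of each cell, added up over disjoint
  cells.\<close>

lemma cell_form_le: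
  assumes "square_integrable N u"
  shows "cell_form N J S u u \<le> (\<integral>x. (u x)\<^sup>2 \<partial>N)"
proof -
  have i: "integrable N (\<lambda>x. (u x)\<^sup>2)" using assms unfolding square_integrable_def by auto
  have "cell_form N J S u u \<le> (\<Sum>i\<in>J. LINT x:S i|N. (u x)\<^sup>2)"
    unfolding cell_form_def
    using set_integral_square_le[OF assms cells] by (intro sum_mono) (simp add: power2_eq_square)
  also have "\<dots> = (LINT x:(\<Union>i\<in>J. S i)|N. (u x)\<^sup>2)"
  proof (rule set_integral_finite_Union[symmetric])
    show "set_integrable N (S j) (\<lambda>x. (u x)\<^sup>2)" if "j \<in> J" for j
      unfolding set_integrable_def using i that by (intro integrable_mult_indicator) auto
  qed (use fin disj in auto)
  also have "\<dots> \<le> (\<integral>x. (u x)\<^sup>2 \<partial>N)"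
    unfolding set_lebesgue_integral_def
    using i fin by (intro integral_mono integrable_mult_indicator) (auto simp: indicator_def)
  finally show ?thesis .
qed

lemma residual_nonneg: "square_integrable N u \<Longrightarrow> residual u \<ge> 0"
  using cell_form_le unfolding residual_def by simp

lemma residual_le: "residual u \<le> (\<integral>x. (u x)\<^sup>2 \<partial>N)"
  unfolding residual_def cell_form_def
  by (simp add: sum_nonneg)

lemma residual_cmult: "residual (\<lambda>x. c * u x) = c\<^sup>2 * residual u"
proof -
  have "(LINT x:S i|N. c * u x) = c * (LINT x:S i|N. u x)" for i
    by simp
  then show ?thesis
    unfolding residual_def cell_form_def
    by (simp add: power_mult_distrib right_diff_distrib sum_distrib_left power2_eq_square mult_ac)
qed

lemma cell_form_add:
  assumes "square_integrable N u" "square_integrable N v"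
  shows "cell_form N J S (\<lambda>x. u x + v x) (\<lambda>x. u x + v x) =
    cell_form N J S u u + 2 * cell_form N J S u v + cell_form N J S v v"
proof -
  have "(LINT x:S i|N. u x + v x) = (LINT x:S i|N. u x) + (LINT x:S i|N. v x)" if "i \<in> J" for i
    using assms that by (intro set_integral_add square_integrable_set_integrable) auto
  then have "cell_form N J S (\<lambda>x. u x + v x) (\<lambda>x. u x + v x) =
    (\<Sum>i\<in>J. (LINT x:S i|N. u x) * (LINT x:S i|N. u x) / measure N (S i)
         + 2 * ((LINT x:S i|N. u x) * (LINT x:S i|N. v x) / measure N (S i))
         + (LINT x:S i|N. v x) * (LINT x:S i|N. v x) / measure N (S i))"
    unfolding cell_form_def
    by (intro sum.cong) (auto simp: distrib_left distrib_right add_divide_distrib mult.commute)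
  then show ?thesis
    unfolding cell_form_def by (simp add: sum.distrib sum_distrib_left)
qed

lemma integral_square_add:
  assumes "square_integrable N u" "square_integrable N v"
  shows "(\<integral>x. (u x + v x)\<^sup>2 \<partial>N) = (\<integral>x. (u x)\<^sup>2 \<partial>N) + 2 * (\<integral>x. u x * v x \<partial>N) + (\<integral>x. (v x)\<^sup>2 \<partial>N)"
proof -
  have "(\<integral>x. (u x + v x)\<^sup>2 \<partial>N) = (\<integral>x. (u x)\<^sup>2 + 2 * (u x * v x) + (v x)\<^sup>2 \<partial>N)"
    by (simp add: power2_sum algebra_simps)
  then show ?thesis
    using assms square_integrable_mult[OF assms] unfolding square_integrable_def by simp
qed

text \<open>The mixed term is the quantity that has to vanish in the limit, so the residuals of
  \<open>u\<close>, \<open>v\<close> and \<open>u + v\<close> control it by polarization.\<close>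

lemma residual_add:
  assumes "square_integrable N u" "square_integrable N v"
  shows "residual (\<lambda>x. u x + v x) =
    residual u + 2 * ((\<integral>x. u x * v x \<partial>N) - cell_form N J S u v) + residual v"
  unfolding residual_def using cell_form_add[OF assms] integral_square_add[OF assms]
  by simp

text \<open>The parallelogram law, with the residual of \<open>u - v\<close> dropped.\<close>

lemma residual_add_le:
  assumes u: "square_integrable N u" and v: "square_integrable N v"
  shows "residual (\<lambda>x. u x + v x) \<le> 2 * residual u + 2 * residual v"
proof -
  have mv: "square_integrable N (\<lambda>x. (-1) * v x)"
    using v by (rule square_integrable_cmult)
  have cf: "cell_form N J S u (\<lambda>x. (-1) * v x) = - cell_form N J S u v"
    unfolding cell_form_def by (simp add: set_lebesgue_integral_def sum_negf)
  have "0 \<le> residual (\<lambda>x. u x + (-1) * v x)"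
    using square_integrable_add[OF u mv] by (rule residual_nonneg)
  also have "\<dots> = residual u - 2 * ((\<integral>x. u x * v x \<partial>N) - cell_form N J S u v) + residual v"
    using residual_add[OF u mv] residual_cmult[of "-1" v] cf by simp
  finally show ?thesis
    using residual_add[OF u v] by simp
qed

text \<open>On a cell of mass \<open>b\<close> that meets \<open>A\<close> in mass \<open>a\<close>,
  the indicator leaves the residual \<open>a - a\<^sup>2 / b\<close>. This is 0 if the cell lies
  inside \<open>A\<close> or misses it, and at most \<open>b\<close> otherwise; the cells of the
  last kind lie in \<open>B\<close>.\<close>

lemma residual_indicator_le:
  assumes A[measurable]: "A \<in> sets N" and B: "B \<in> sets N"
    and cover: "measure N (\<Union>i\<in>J. S i) = 1"
    and cut: "\<And>i. i \<in> J \<Longrightarrow> S i \<subseteq> A \<or> S i \<inter> A = {} \<or> S i \<subseteq> B"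
  shows "residual (indicator A) \<le> measure N B"
proof -
  let ?U = "\<Union>i\<in>J. S i"
  have [measurable]: "?U \<in> sets N" using fin by auto
  \<comment> \<open>The cells fill the space up to a null set, so the mass of \<open>A\<close>
    splits over them.\<close>
  have "AE x in N. x \<in> ?U" using cover by (simp add: prob_eq_1)
  then have "measure N A = measure N (\<Union>i\<in>J. S i \<inter> A)"
    by (intro finite_measure_eq_AE) (use fin in auto)
  also have "\<dots> = (\<Sum>i\<in>J. measure N (S i \<inter> A))"
    using fin disj by (intro finite_measure_finite_Union) (auto simp: disjoint_family_on_def)
  finally have mA: "measure N A = (\<Sum>i\<in>J. measure N (S i \<inter> A))" .
  have int: "(LINT x:S i|N. indicator A x) = measure N (S i \<inter> A)" if "i \<in> J" for i
    using that unfolding set_lebesgue_integral_def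
    by (simp flip: indicator_inter_arith)
  have "residual (indicator A) = (\<Sum>i\<in>J. measure N (S i \<inter> A) - (measure N (S i \<inter> A))\<^sup>2 / measure N (S i))"
    using mA int unfolding residual_def cell_form_def
    by (simp add: sum_subtractf power2_eq_square flip: indicator_inter_arith)
  also have "\<dots> \<le> (\<Sum>i\<in>J. measure N (S i \<inter> B))"
  proof (rule sum_mono)
    fix i assume i: "i \<in> J"
    consider "S i \<subseteq> A" | "S i \<inter> A = {}" | "S i \<subseteq> B" using cut[OF i] by blast
    then show "measure N (S i \<inter> A) - (measure N (S i \<inter> A))\<^sup>2 / measure N (S i) \<le> measure N (S i \<inter> B)"
    proof cases
      case 1
      then have "S i \<inter> A = S i" by blast
      then show ?thesis by (simp add: power2_eq_square)
    next
      case 2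
      then show ?thesis by simp
    next
      case 3
      then have "S i \<inter> B = S i" by blast
      moreover have "measure N (S i \<inter> A) \<le> measure N (S i)"
        using i by (intro finite_measure_mono) auto
      moreover have "measure N (S i \<inter> A) - (measure N (S i \<inter> A))\<^sup>2 / measure N (S i)
          \<le> measure N (S i \<inter> A)"
        by simp
      ultimately show ?thesis by (metis order_trans)
    qed
  qed
  also have "\<dots> = measure N (\<Union>i\<in>J. S i \<inter> B)"
    using fin disj B
    by (intro finite_measure_finite_Union[symmetric]) (auto simp: disjoint_family_on_def)
  also have "\<dots> \<le> measure N B"
    using B by (intro finite_measure_mono) auto
  finally show ?thesis .
qed

end

section \<open>Strong convergence of the projections along a sequence of cell families\<close>

lemma tendsto_zero_if_approximable:
  fixes D :: "nat \<Rightarrow> real"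
  assumes nonneg: "\<And>n. 0 \<le> D n"
    and le: "\<And>n k. D n \<le> a k + E k n"
    and a: "a \<longlonglongrightarrow> 0" and E: "\<And>k. E k \<longlonglongrightarrow> 0"
  shows "D \<longlonglongrightarrow> 0"
proof (rule LIMSEQ_I)
  fix e :: real assume e: "e > 0"
  \<comment> \<open>The index \<open>k\<close> is fixed first, through the error \<open>a k\<close>
    that is uniform in \<open>n\<close>; only then is \<open>n\<close> made large for this
    \<open>k\<close>.\<close>
  have "eventually (\<lambda>k. a k < e / 2) sequentially"
    using a e by (intro order_tendstoD(2)) auto
  then obtain k where k: "a k < e / 2" by (auto simp: eventually_sequentially)
  have "eventually (\<lambda>n. E k n < e / 2) sequentially"
    using E e by (intro order_tendstoD(2)[OF E]) auto
  then have "eventually (\<lambda>n. norm (D n - 0) < e) sequentially"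
  proof eventually_elim
    case (elim n)
    then show ?case using le[of n k] k nonneg[of n] by simp
  qed
  then show "\<exists>no. \<forall>n\<ge>no. norm (D n - 0) < e"
    by (auto simp: eventually_sequentially)
qed

text \<open>The families are not assumed to refine one another, so martingale convergence is not at
  hand; vanishing residuals on an intersection-stable generator replace it. The whole space is
  listed separately because it need not belong to \<open>G\<close>, and the constant 1 has a
  positive residual when the cells leave mass uncovered.\<close>

locale cell_family_sequence =
  fixes N :: "'a measure" and J :: "nat \<Rightarrow> 'i set" and S :: "nat \<Rightarrow> 'i \<Rightarrow> 'a set"
    and G :: "'a set set"
  assumes family: "\<And>n. cell_family N (J n) (S n)"
    and gen: "Int_stable G" "G \<subseteq> Pow (space N)" "sets N = sigma_sets (space N) G"
    and residual_gen: "\<And>A. A \<in> insert (space N) G \<Longrightarrow>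
      (\<lambda>n. cell_family.residual N (J n) (S n) (indicator A)) \<longlonglongrightarrow> 0"
begin

abbreviation "res n \<equiv> cell_family.residual N (J n) (S n)"

lemma prob: "prob_space N"
  using family[of 0] unfolding cell_family_def by simp

sublocale prob_space N by (rule prob)

lemma residual_add_tendsto:
  assumes "square_integrable N u" "square_integrable N v"
    and "(\<lambda>n. res n u) \<longlonglongrightarrow> 0" "(\<lambda>n. res n v) \<longlonglongrightarrow> 0"
  shows "(\<lambda>n. res n (\<lambda>x. u x + v x)) \<longlonglongrightarrow> 0"
proof (rule tendsto_sandwich[OF _ _ tendsto_const])
  show "\<forall>\<^sub>F n in sequentially. 0 \<le> res n (\<lambda>x. u x + v x)"
    by (intro always_eventually allI cell_family.residual_nonneg[OF family square_integrable_add[OF assms(1,2)]])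
  show "\<forall>\<^sub>F n in sequentially. res n (\<lambda>x. u x + v x) \<le> 2 * res n u + 2 * res n v"
    by (intro always_eventually allI cell_family.residual_add_le[OF family assms(1,2)])
  show "(\<lambda>n. 2 * res n u + 2 * res n v) \<longlonglongrightarrow> 0"
    by (rule tendsto_eq_rhs[OF tendsto_add[OF tendsto_mult_left[OF assms(3)] tendsto_mult_left[OF assms(4)]]]) simp
qed

lemma residual_cmult_tendsto:
  assumes "(\<lambda>n. res n u) \<longlonglongrightarrow> 0"
  shows "(\<lambda>n. res n (\<lambda>x. c * u x)) \<longlonglongrightarrow> 0"
  using tendsto_mult_left[OF assms, of "c\<^sup>2"] by (simp add: cell_family.residual_cmult[OF family])

lemma residual_diff_tendsto:
  assumes "square_integrable N u" "square_integrable N v"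
    and "(\<lambda>n. res n u) \<longlonglongrightarrow> 0" "(\<lambda>n. res n v) \<longlonglongrightarrow> 0"
  shows "(\<lambda>n. res n (\<lambda>x. u x - v x)) \<longlonglongrightarrow> 0"
  using residual_add_tendsto[OF assms(1) square_integrable_cmult[OF assms(2), of "-1"]
      assms(3) residual_cmult_tendsto[OF assms(4), of "-1"]]
  by simp

text \<open>The functions with vanishing residual are closed in \<open>L\<^sup>2\<close>: the
  residual of \<open>u\<close> is at most twice that of \<open>s k\<close> plus twice that of
  \<open>u - s k\<close>, and the latter is at most the squared distance, uniformly in
  \<open>n\<close>.\<close>

lemma residual_approx_tendsto:
  assumes u: "square_integrable N u" and s: "\<And>k. square_integrable N (s k)"
    and lim: "(\<lambda>k. \<integral>x. (u x - s k x)\<^sup>2 \<partial>N) \<longlonglongrightarrow> 0"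
    and res: "\<And>k. (\<lambda>n. res n (s k)) \<longlonglongrightarrow> 0"
  shows "(\<lambda>n. res n u) \<longlonglongrightarrow> 0"
proof (rule tendsto_zero_if_approximable)
  show "0 \<le> res n u" for n
    using cell_family.residual_nonneg[OF family u] .
  show "res n u \<le> 2 * (\<integral>x. (u x - s k x)\<^sup>2 \<partial>N) + 2 * res n (s k)" for n k
    using cell_family.residual_add_le[OF family square_integrable_diff[OF u s] s, of n k k]
      cell_family.residual_le[OF family, of n "\<lambda>x. u x - s k x"]
    by simp
  show "(\<lambda>k. 2 * (\<integral>x. (u x - s k x)\<^sup>2 \<partial>N)) \<longlonglongrightarrow> 0"
    using tendsto_mult_left[OF lim, of 2] by simp
  show "(\<lambda>n. 2 * res n (s k)) \<longlonglongrightarrow> 0" for k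
    using tendsto_mult_left[OF res[of k], of 2] by simp
qed

text \<open>Dynkin's argument: complements are differences of indicators, finite disjoint unions are
  sums, and a countable disjoint union is the \<open>L\<^sup>2\<close> limit of its partial
  unions.\<close>

lemma residual_indicator_tendsto:
  assumes "A \<in> sets N"
  shows "(\<lambda>n. res n (indicator A)) \<longlonglongrightarrow> 0"
proof -
  have sp: "(\<lambda>n. res n (indicator (space N))) \<longlonglongrightarrow> 0" using residual_gen by simp
  have sets: "sigma_sets (space N) G = sets N" using gen by simp
  have "A \<in> sigma_sets (space N) G" using assms gen by simp
  then show ?thesis
  proof (induction rule: sigma_sets_induct_disjoint[OF gen(1,2), consumes 1, case_names basic empty compl union])
    case (basic A)
    then show ?case using residual_gen by simp
  next
    case empty
    show ?case using residual_cmult_tendsto[OF sp, of 0] by (simp add: indicator_def)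
  next
    case (compl A)
    have A: "A \<in> sets N" using compl sets by simp
    have "(indicator (space N - A) :: 'a \<Rightarrow> real) = (\<lambda>x. indicator (space N) x - indicator A x)"
      using sets.sets_into_space[OF A] by (auto simp: fun_eq_iff indicator_def)
    then show ?case
      using residual_diff_tendsto[OF square_integrable_indicator square_integrable_indicator sp compl.IH] A
      by simp
  next
    case (union A)
    have A: "A k \<in> sets N" for k using union sets by auto
    have sq: "square_integrable N (indicator (\<Union>i<k. A i))" for k :: nat
      using A by (intro square_integrable_indicator) auto
    have step: "(\<lambda>n. res n (indicator (\<Union>i<k. A i))) \<longlonglongrightarrow> 0" for k :: nat
    proof (induction k)
      case 0
      show ?case using residual_cmult_tendsto[OF sp, of 0] by (simp add: indicator_def)
    next
      case (Suc k)
      have "A i \<inter> A k = {}" if "i < k" for i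
        using union(1) that unfolding disjoint_family_on_def by simp
      then have "(\<Union>i<k. A i) \<inter> A k = {}" by blast
      then have "(indicator (\<Union>i<Suc k. A i) :: 'a \<Rightarrow> real) =
          (\<lambda>x. indicator (\<Union>i<k. A i) x + indicator (A k) x)"
        by (subst lessThan_Suc) (auto simp: fun_eq_iff split: split_indicator)
      then show ?case
        using residual_add_tendsto[OF sq[of k] square_integrable_indicator[OF A] Suc.IH union.IH]
        by simp
    qed
    show ?case
    proof (rule residual_approx_tendsto[OF _ sq _ step])
      show "square_integrable N (indicator (\<Union> (range A)))"
        using A by (intro square_integrable_indicator) auto
      have "(\<lambda>k. \<integral>x. (indicator (\<Union> (range A)) x - indicator (\<Union>i<k. A i) x)\<^sup>2 \<partial>N)
          \<longlonglongrightarrow> (\<integral>x. (0::real) \<partial>N)"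
      proof (rule integral_dominated_convergence[where w = "\<lambda>_. 1"])
        show "AE x in N. (\<lambda>k. (indicator (\<Union> (range A)) x - indicator (\<Union>i<k. A i) x)\<^sup>2) \<longlonglongrightarrow> (0::real)"
        proof (rule AE_I2, rule tendsto_eventually)
          fix x
          show "\<forall>\<^sub>F k in sequentially. (indicator (\<Union> (range A)) x - indicator (\<Union>i<k. A i) x)\<^sup>2 = (0::real)"
          proof (cases "x \<in> \<Union> (range A)")
            case True
            then obtain i where "x \<in> A i" by auto
            have "x \<in> (\<Union>i<k. A i)" if "Suc i \<le> k" for k
              using \<open>x \<in> A i\<close> that by (auto simp: Suc_le_eq)
            then show ?thesis
              using True by (intro eventually_sequentiallyI[of "Suc i"]) simp
          next
            case False
            then have "x \<notin> (\<Union>i<k. A i)" for k by blast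
            then show ?thesis using False by simp
          qed
        qed
        show "(\<lambda>x. (indicator (\<Union> (range A)) x - indicator (\<Union>i<k. A i) x)\<^sup>2 :: real) \<in> borel_measurable N" for k
          using A by (intro borel_measurable_power borel_measurable_diff borel_measurable_indicator) auto
        show "AE x in N. norm ((indicator (\<Union> (range A)) x - indicator (\<Union>i<k. A i) x)\<^sup>2 :: real) \<le> 1" for k
          by (intro AE_I2) (simp split: split_indicator)
      qed auto
      then show "(\<lambda>k. \<integral>x. (indicator (\<Union> (range A)) x - indicator (\<Union>i<k. A i) x)\<^sup>2 \<partial>N) \<longlonglongrightarrow> (0::real)"
        by simp
    qed
  qed
qed

text \<open>Monotone class induction from indicators. Square integrability is an inductive premise,
  so every case must first pass it down to the constituents.\<close>

lemma residual_tendsto_nonneg: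
  assumes "u \<in> borel_measurable N" "\<And>x. 0 \<le> u x" "square_integrable N u"
  shows "(\<lambda>n. res n u) \<longlonglongrightarrow> 0"
  using assms
proof (induction rule: borel_measurable_induct_real)
  case (set A)
  then show ?case by (intro residual_indicator_tendsto)
next
  case (mult u c)
  show ?case
  \<comment> \<open>For \<open>c = 0\<close> the premise says nothing about \<open>u\<close>; the
    zero function is then treated as a multiple of an indicator.\<close>
  proof (cases "c = 0")
    case True
    then show ?thesis
      using residual_cmult_tendsto[OF residual_indicator_tendsto[OF sets.empty_sets], of 0] by simp
  next
    case False
    then have "square_integrable N u"
      using square_integrable_cmult[OF mult.prems, of "1/c"] by simp
    then show ?thesis using mult.IH residual_cmult_tendsto by blast
  qed
next
  case (add u v)
  \<comment> \<open>Nonnegative summands are dominated by their sum.\<close>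
  have "square_integrable N u" "square_integrable N v"
    using add by (auto intro!: square_integrable_bound[OF add.prems])
  then show ?case using residual_add_tendsto add.IH by blast
next
  case (seq U)
  have le: "U i x \<le> u x" if "x \<in> space N" for i x
    using seq.hyps(3) seq.hyps(4)[OF that] by (intro incseq_le) (auto simp: incseq_def le_fun_def)
  have U: "square_integrable N (U i)" for i
  proof (rule square_integrable_bound[OF seq.prems])
    show "\<bar>U i x\<bar> \<le> \<bar>u x\<bar>" if "x \<in> space N" for x
      using order_trans[OF le[OF that, of i] abs_ge_self] seq.hyps(2)[of i x] by simp
  qed (rule seq.hyps(1))
  have [measurable]: "u \<in> borel_measurable N" "U i \<in> borel_measurable N" for i
    using seq.prems U unfolding square_integrable_def by auto
  show ?case
  proof (rule residual_approx_tendsto[OF seq.prems U])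
    have "(\<lambda>k. \<integral>x. (u x - U k x)\<^sup>2 \<partial>N) \<longlonglongrightarrow> (\<integral>x. 0 \<partial>N)"
    \<comment> \<open>The majorant works because \<open>0 \<le> U k x \<le> u x\<close>.\<close>
    proof (rule integral_dominated_convergence[where w = "\<lambda>x. (u x)\<^sup>2"])
      show "integrable N (\<lambda>x. (u x)\<^sup>2)" using seq.prems unfolding square_integrable_def by simp
      show "AE x in N. (\<lambda>k. (u x - U k x)\<^sup>2) \<longlonglongrightarrow> 0"
      proof (rule AE_I2)
        fix x assume "x \<in> space N"
        from seq.hyps(4)[OF this] have "(\<lambda>k. (u x - U k x)\<^sup>2) \<longlonglongrightarrow> (u x - u x)\<^sup>2"
          by (intro tendsto_intros)
        then show "(\<lambda>k. (u x - U k x)\<^sup>2) \<longlonglongrightarrow> 0" by simp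
      qed
      show "AE x in N. norm ((u x - U k x)\<^sup>2) \<le> (u x)\<^sup>2" for k
        using le seq.hyps(2) by (intro AE_I2) (auto intro!: power_mono)
    qed auto
    then show "(\<lambda>k. \<integral>x. (u x - U k x)\<^sup>2 \<partial>N) \<longlonglongrightarrow> 0" by simp
    show "(\<lambda>n. res n (U k)) \<longlonglongrightarrow> 0" for k
      using seq.IH[OF U] .
  qed
qed

lemma residual_tendsto:
  assumes "square_integrable N u"
  shows "(\<lambda>n. res n u) \<longlonglongrightarrow> 0"
proof -
  let ?p = "\<lambda>x. max 0 (u x)" and ?m = "\<lambda>x. max 0 (- u x)"
  have [measurable]: "u \<in> borel_measurable N" using assms unfolding square_integrable_def by simp
  have p: "square_integrable N ?p" and m: "square_integrable N ?m"
    by (rule square_integrable_bound[OF assms]; simp)+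
  have "u = (\<lambda>x. ?p x - ?m x)" by auto
  moreover have "(\<lambda>n. res n (\<lambda>x. ?p x - ?m x)) \<longlonglongrightarrow> 0"
    using p m p[unfolded square_integrable_def, THEN conjunct1] m[unfolded square_integrable_def, THEN conjunct1]
    by (intro residual_diff_tendsto residual_tendsto_nonneg max.cobounded1)
  ultimately show ?thesis by (rule ssubst[where P = "\<lambda>w. (\<lambda>n. res n w) \<longlonglongrightarrow> 0"])
qed

text \<open>Polarization: the defect of the bilinear form is half the residual of
  \<open>u + v\<close> minus those of \<open>u\<close> and \<open>v\<close>, and all three tend to
  0.\<close>

theorem cell_form_tendsto:
  assumes u: "square_integrable N u" and v: "square_integrable N v"
  shows "(\<lambda>n. cell_form N (J n) (S n) u v) \<longlonglongrightarrow> (\<integral>x. u x * v x \<partial>N)"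
proof -
  let ?I = "\<integral>x. u x * v x \<partial>N"
  have uv: "square_integrable N (\<lambda>x. u x + v x)" using u v by (rule square_integrable_add)
  have "(\<lambda>n. ?I - (res n (\<lambda>x. u x + v x) - res n u - res n v) / 2) \<longlonglongrightarrow> ?I - (0 - 0 - 0) / 2"
    using residual_tendsto[OF u] residual_tendsto[OF v]
      residual_tendsto[OF uv]
    by (intro tendsto_intros) auto
  moreover have "?I - (res n (\<lambda>x. u x + v x) - res n u - res n v) / 2 = cell_form N (J n) (S n) u v" for n
    using cell_family.residual_add[OF family u v, of n] by (simp add: field_simps)
  ultimately show ?thesis by simp
qed

end

section \<open>Quantiles and strata\<close>

lemma prob_density_prob_space:
  "prob_density h \<Longrightarrow> prob_space (density lborel (\<lambda>x. ennreal (h x)))"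
  unfolding prob_density_def by (intro prob_spaceI) (auto simp: emeasure_density)

lemma prob_density_real_distribution:
  "prob_density h \<Longrightarrow> real_distribution (density lborel (\<lambda>x. ennreal (h x)))"
  using prob_density_prob_space by (intro real_distribution.intro) (auto simp: real_distribution_axioms_def)

lemma prob_density_isCont_cdf:
  assumes "prob_density h"
  shows "isCont (cdf (density lborel (\<lambda>x. ennreal (h x)))) x"
proof -
  interpret real_distribution "density lborel (\<lambda>x. ennreal (h x))"
    using assms by (rule prob_density_real_distribution)
  have [measurable]: "h \<in> borel_measurable borel" using assms unfolding prob_density_def by simp
  have "emeasure (density lborel (\<lambda>x. ennreal (h x))) {x} = 0"
    by (subst emeasure_density) (auto simp: nn_integral_0_iff_AE intro!: AE_mp[OF AE_lborel_singleton[of x]])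
  then show ?thesis by (simp add: isCont_cdf measure_def)
qed

section \<open>The probability integral transform for continuous distribution functions\<close>

context real_distribution
begin

lemma cdf_borel_measurable [measurable]: "cdf M \<in> borel_measurable borel"
  by (intro borel_measurable_mono monoI cdf_nondecreasing)

lemma cdf_surj:
  assumes cont: "\<And>x. isCont (cdf M) x" and u: "0 < u" "u < 1"
  shows "\<exists>a. cdf M a = u"
proof -
  have "eventually (\<lambda>x. cdf M x < u) at_bot"
    using cdf_lim_at_bot u by (intro order_tendstoD(2)) auto
  then obtain a where a: "cdf M a < u" by (auto simp: eventually_at_bot_linorder)
  have "eventually (\<lambda>x. u < cdf M x) at_top"
    using cdf_lim_at_top_prob u by (intro order_tendstoD(1)) auto
  then obtain b where b: "u < cdf M b" by (auto simp: eventually_at_top_linorder)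
  have "a \<le> b" using a b cdf_nondecreasing[of b a] by (meson le_cases not_less order_trans less_trans)
  then show ?thesis
    using IVT[of "cdf M" a u b] a b cont by auto
qed

text \<open>Half of the fact that the rank of a point is uniformly distributed. Each level
  \<open>w\<close> strictly between \<open>u\<close> and 1 is attained at some \<open>a\<close>, and
  \<open>{..a}\<close> has mass \<open>w\<close> and contains the set; then \<open>w\<close>
  decreases to \<open>u\<close>.\<close>

lemma measure_cdf_le:
  assumes cont: "\<And>x. isCont (cdf M) x" and u: "0 \<le> u" "u \<le> 1"
  shows "measure M {x. cdf M x \<le> u} \<le> u"
proof (cases "u = 1")
  case False
  show ?thesis
  proof (rule dense_ge_bounded[of u 1])
    fix w assume w: "u < w" "w < 1"
    then obtain a where a: "cdf M a = w" using cdf_surj[OF cont, of w] u by auto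
    have "{x. cdf M x \<le> u} \<subseteq> {..a}"
      using cdf_nondecreasing[of a] a w by (auto simp: not_le[symmetric]) (meson linear not_le order_trans)
    then have "measure M {x. cdf M x \<le> u} \<le> measure M {..a}"
      by (intro finite_measure_mono) auto
    then show "measure M {x. cdf M x \<le> u} \<le> w" using a unfolding cdf_def by simp
  qed (use u False in auto)
qed simp

lemma measure_cdf_ge:
  assumes cont: "\<And>x. isCont (cdf M) x" and u: "0 \<le> u" "u \<le> 1"
  shows "measure M {x. u \<le> cdf M x} \<le> 1 - u"
proof (cases "u = 0")
  case False
  have "u \<le> 1 - measure M {x. u \<le> cdf M x}"
  proof (rule dense_le_bounded[of 0 u])
    fix w assume w: "0 < w" "w < u"
    then obtain a where a: "cdf M a = w" using cdf_surj[OF cont, of w] u by auto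
    have "{x. u \<le> cdf M x} \<subseteq> space M - {..a}"
      using cdf_nondecreasing[of _ a] a w by (auto simp: not_le[symmetric]) (meson not_le order_trans)
    then have "measure M {x. u \<le> cdf M x} \<le> measure M (space M - {..a})"
      by (intro finite_measure_mono) auto
    also have "\<dots> = 1 - w" using a unfolding cdf_def by (subst prob_compl) auto
    finally show "w \<le> 1 - measure M {x. u \<le> cdf M x}" by simp
  qed (use u False in auto)
  then show ?thesis by simp
qed simp

text \<open>A level set may be a whole interval but carries no mass: the points of rank above
  \<open>u\<close> already have mass at least \<open>1 - u\<close>, and those of rank at least
  \<open>u\<close> have at most that.\<close>

lemma measure_cdf_eq:
  assumes cont: "\<And>x. isCont (cdf M) x" and u: "0 \<le> u" "u \<le> 1"
  shows "measure M {x. cdf M x = u} = 0"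
proof -
  have "{x. cdf M x \<le> u} \<union> {x. u < cdf M x} = space M" by auto
  then have "1 = measure M ({x. cdf M x \<le> u} \<union> {x. u < cdf M x})"
    using prob_space by presburger
  also have "\<dots> = measure M {x. cdf M x \<le> u} + measure M {x. u < cdf M x}"
    by (intro finite_measure_Union) auto
  finally have "1 - u \<le> measure M {x. u < cdf M x}" using measure_cdf_le[OF assms] by simp
  moreover have "measure M {x. u \<le> cdf M x} = measure M ({x. u < cdf M x} \<union> {x. cdf M x = u})"
    by (auto intro!: arg_cong[where f = "measure M"])
  moreover have "\<dots> = measure M {x. u < cdf M x} + measure M {x. cdf M x = u}"
    by (intro finite_measure_Union) auto
  ultimately have "measure M {x. cdf M x = u} \<le> 0"
    using measure_cdf_ge[OF assms] by simp
  then show ?thesis using measure_nonneg[of M "{x. cdf M x = u}"] by simp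
qed

end

section \<open>Masses of quantile intervals\<close>

lemma quantile_mono: "u \<le> v \<Longrightarrow> quantile h u \<le> quantile h v"
  unfolding quantile_def Let_def by (intro Inf_superset_mono image_mono) auto

text \<open>If the distribution function exceeded \<open>u\<close> at \<open>x\<close>, by
  continuity it would do so slightly to the left of \<open>x\<close>, which would push the quantile
  below \<open>x\<close>.\<close>

lemma cdf_le_if_le_quantile:
  assumes h: "prob_density h" and u: "0 \<le> u" and x: "ereal x \<le> quantile h u"
  shows "cdf (density lborel (\<lambda>x. ennreal (h x))) x \<le> u"
proof (rule ccontr)
  let ?H = "cdf (density lborel (\<lambda>x. ennreal (h x)))"
  assume "\<not> ?H x \<le> u"
  then have "eventually (\<lambda>y. u < ?H y) (at x)"
    using prob_density_isCont_cdf[OF h, of x] unfolding isCont_def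
    by (intro order_tendstoD(1)) auto
  then obtain d where d: "d > 0" "\<And>y. y \<noteq> x \<Longrightarrow> dist y x < d \<Longrightarrow> u < ?H y"
    by (auto simp: eventually_at)
  have "u < ?H (x - d / 2)" using d(1) by (intro d(2)) (auto simp: dist_real_def)
  \<comment> \<open>As \<open>0 \<le> u\<close>, the distribution function is positive at this
    point, as membership in the set defining the quantile demands.\<close>
  then have "quantile h u \<le> ereal (x - d / 2)"
    using u unfolding quantile_def Let_def by (intro Inf_lower) auto
  with x have "ereal x \<le> ereal (x - d / 2)" by (rule order_trans)
  then show False using d(1) by simp
qed

lemma le_cdf_if_quantile_less:
  assumes h: "prob_density h" and x: "quantile h u < ereal x"
  shows "u \<le> cdf (density lborel (\<lambda>x. ennreal (h x))) x"
proof -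
  interpret real_distribution "density lborel (\<lambda>x. ennreal (h x))"
    using h by (rule prob_density_real_distribution)
  let ?H = "cdf (density lborel (\<lambda>x. ennreal (h x)))"
  obtain y where "?H y \<ge> u" "y < x"
    using x unfolding quantile_def Let_def by (auto simp: Inf_less_iff)
  then show ?thesis using cdf_nondecreasing[of y x] by simp
qed

text \<open>The set lies in \<open>{H \<le> u}\<close>, of mass at most \<open>u\<close>, and its
  complement in \<open>{H \<ge> u}\<close>, of mass at most \<open>1 - u\<close>; as the masses add
  up to 1, equality holds. Infinite quantiles thus require no separate case.\<close>

lemma measure_le_quantile:
  assumes h: "prob_density h" and u: "0 \<le> u" "u \<le> 1"
  shows "measure (density lborel (\<lambda>x. ennreal (h x))) {x. ereal x \<le> quantile h u} = u"
proof -
  define M where "M = density lborel (\<lambda>x. ennreal (h x))"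
  interpret real_distribution M
    unfolding M_def using h by (rule prob_density_real_distribution)
  have cont: "isCont (cdf M) x" for x
    unfolding M_def using h by (rule prob_density_isCont_cdf)
  have "measure M {x. ereal x \<le> quantile h u} \<le> measure M {x. cdf M x \<le> u}"
    using cdf_le_if_le_quantile[OF h u(1)] unfolding M_def[symmetric]
    by (intro finite_measure_mono) auto
  moreover have "measure M (space M - {x. ereal x \<le> quantile h u}) \<le> measure M {x. u \<le> cdf M x}"
    using le_cdf_if_quantile_less[OF h, of u] unfolding M_def[symmetric]
    by (intro finite_measure_mono) (auto simp: not_le)
  moreover have "measure M (space M - {x. ereal x \<le> quantile h u}) = 1 - measure M {x. ereal x \<le> quantile h u}"
    by (rule prob_compl) auto
  ultimately have "measure M {x. ereal x \<le> quantile h u} = u"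
    using measure_cdf_le[OF cont u] measure_cdf_ge[OF cont u] by simp
  then show ?thesis unfolding M_def .
qed

lemma measure_quantile_cell:
  assumes h: "prob_density h" and u: "0 \<le> u" "u \<le> v" "v \<le> 1"
  shows "measure (density lborel (\<lambda>x. ennreal (h x)))
    {x. quantile h u < ereal x \<and> ereal x \<le> quantile h v} = v - u"
proof -
  interpret real_distribution "density lborel (\<lambda>x. ennreal (h x))"
    using h by (rule prob_density_real_distribution)
  let ?M = "density lborel (\<lambda>x. ennreal (h x))"
  have "{x. quantile h u < ereal x \<and> ereal x \<le> quantile h v} =
      {x. ereal x \<le> quantile h v} - {x. ereal x \<le> quantile h u}"
    by auto
  also have "measure ?M \<dots> = measure ?M {x. ereal x \<le> quantile h v} - measure ?M {x. ereal x \<le> quantile h u}"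
    using order_trans[OF _ quantile_mono[OF u(2), of h]] by (intro finite_measure_Diff) auto
  finally show ?thesis using measure_le_quantile[OF h] u by simp
qed

section \<open>Product densities and the masses of strata\<close>

lemma product_density_nonneg: "(\<And>k. prob_density (gs k)) \<Longrightarrow> 0 \<le> product_density gs x"
  unfolding product_density_def prob_density_def by (auto intro: prod_nonneg)

lemma product_density_measurable:
  "(\<And>k. prob_density (gs k)) \<Longrightarrow> product_density gs \<in> borel_measurable borel"
proof -
  assume "\<And>k. prob_density (gs k)"
  then have [measurable]: "gs k \<in> borel_measurable borel" for k unfolding prob_density_def by simp
  show ?thesis unfolding product_density_def[abs_def] by measurable
qed

lemma emeasure_product_density_box:
  fixes gs :: "'m::finite \<Rightarrow> real \<Rightarrow> real"
  assumes gs: "\<And>k. prob_density (gs k)" and A[measurable]: "\<And>k. A k \<in> sets borel"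
  shows "emeasure (density lborel (\<lambda>x. ennreal (product_density gs x))) {x. \<forall>k. x $ k \<in> A k} =
    (\<Prod>k\<in>UNIV. emeasure (density lborel (\<lambda>x. ennreal (gs k x))) (A k))"
proof -
  have [measurable]: "gs k \<in> borel_measurable borel" for k
    using gs unfolding prob_density_def by simp
  have nn: "0 \<le> gs k x" for k x
    using gs unfolding prob_density_def by simp
  \<comment> \<open>Tonelli for \<open>lborel\<close> takes a product over \<open>Basis\<close>;
    \<open>e\<close> matches coordinates with basis vectors, and \<open>F\<close> is the
    corresponding one-dimensional factor.\<close>
  define e where "e = (\<lambda>k::'m. axis k (1::real))"
  have inj: "inj e" unfolding e_def by (auto simp: inj_def axis_eq_axis)
  have basis: "Basis = range e" unfolding e_def Basis_vec_def by auto
  define F where "F = (\<lambda>b x. ennreal (gs (inv e b) x) * indicator (A (inv e b)) x)"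
  have [measurable]: "product_density gs \<in> borel_measurable borel"
    using gs by (rule product_density_measurable)
  have "emeasure (density lborel (\<lambda>x. ennreal (product_density gs x))) {x. \<forall>k. x $ k \<in> A k} =
      (\<integral>\<^sup>+x. ennreal (product_density gs x) * indicator {x. \<forall>k. x $ k \<in> A k} x \<partial>lborel)"
    by (intro emeasure_density) auto
  also have "\<dots> = (\<integral>\<^sup>+x. (\<Prod>b\<in>Basis. F b (x \<bullet> b)) \<partial>lborel)"
  proof (intro nn_integral_cong)
    fix x :: "real^'m"
    have "(\<Prod>b\<in>Basis. F b (x \<bullet> b)) = (\<Prod>k\<in>UNIV. F (e k) (x $ k))"
      unfolding basis prod.reindex[OF inj] by (simp add: e_def inner_axis)
    also have "\<dots> = (\<Prod>k\<in>UNIV. ennreal (gs k (x $ k))) * (\<Prod>k\<in>UNIV. indicator (A k) (x $ k))"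
      unfolding F_def by (simp add: inv_f_f[OF inj] prod.distrib)
    also have "(\<Prod>k\<in>UNIV. ennreal (gs k (x $ k))) = ennreal (product_density gs x)"
      unfolding product_density_def using nn by (intro prod_ennreal) auto
    also have "(\<Prod>k\<in>UNIV. indicator (A k) (x $ k)) = (indicator {x. \<forall>k. x $ k \<in> A k} x :: ennreal)"
      by (auto simp: indicator_def)
    finally show "ennreal (product_density gs x) * indicator {x. \<forall>k. x $ k \<in> A k} x =
        (\<Prod>b\<in>Basis. F b (x \<bullet> b))" ..
  qed
  also have "\<dots> = (\<Prod>b\<in>Basis. \<integral>\<^sup>+x. F b x \<partial>lborel)"
    unfolding F_def by (intro nn_integral_lborel_prod) auto
  also have "\<dots> = (\<Prod>k\<in>UNIV. \<integral>\<^sup>+x. F (e k) x \<partial>lborel)"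
    unfolding basis prod.reindex[OF inj] by simp
  also have "\<dots> = (\<Prod>k\<in>UNIV. emeasure (density lborel (\<lambda>x. ennreal (gs k x))) (A k))"
    unfolding F_def by (simp add: inv_f_f[OF inj] emeasure_density)
  finally show ?thesis .
qed

lemma strata_indices_eq: "strata_indices I = PiE UNIV (\<lambda>_. {1..I})"
  unfolding strata_indices_def by (auto simp: PiE_def Pi_def)

lemma finite_strata_indices: "finite (strata_indices I)"
  unfolding strata_indices_eq by (intro finite_PiE) auto

lemma card_strata_indices: "card (strata_indices I :: ('m::finite \<Rightarrow> nat) set) = I ^ CARD('m)"
  unfolding strata_indices_eq by (simp add: card_PiE)

lemma stratum_measurable [measurable]: "stratum gs I i \<in> sets borel"
  unfolding stratum_def by measurable

lemma disjoint_strata: "disjoint_family_on (stratum gs I) (strata_indices I)"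
proof -
  have *: "stratum gs I i \<inter> stratum gs I j = {}" if "i k < j k" for i j k
  proof -
    \<comment> \<open>Indices are integers, so \<open>i k \<le> j k - 1\<close>: side
      \<open>k\<close> of the cell \<open>j\<close> begins no earlier than that of \<open>i\<close>
      ends.\<close>
    have "real (i k) / real I \<le> (real (j k) - 1) / real I"
      using that by (intro divide_right_mono) auto
    from quantile_mono[OF this, of "gs k"] show ?thesis
      unfolding stratum_def by (fastforce dest: spec[of _ k])
  qed
  show ?thesis
    unfolding disjoint_family_on_def
  proof (intro ballI impI)
    fix i j :: "'a \<Rightarrow> nat" assume "i \<noteq> j"
    then obtain k where "i k < j k \<or> j k < i k" by (metis ext nat_neq_iff)
    then show "stratum gs I i \<inter> stratum gs I j = {}" using *[of i k j] *[of j k i] by blast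
  qed
qed

text \<open>The two almost-everywhere conditions are what (A1) yields: \<open>chi_ge\<close> from
  the essential infimum, \<open>chi_ac\<close> from the finite integral of
  \<open>chi\<^sup>2 / g\<close>. Together they make the measures \<gamma> and \<nu> mutually
  absolutely continuous.\<close>

locale strata_density =
  fixes gs :: "'m::finite \<Rightarrow> real \<Rightarrow> real" and chi :: "real^'m \<Rightarrow> real" and c :: real
  assumes gs: "\<And>k. prob_density (gs k)"
    and chi: "prob_density chi"
    and c_pos: "c > 0"
    and chi_ge: "AE x in lborel. c * product_density gs x \<le> chi x"
    and chi_ac: "AE x in lborel. product_density gs x = 0 \<longrightarrow> chi x = 0"
begin

abbreviation "\<gamma> \<equiv> density lborel (\<lambda>x. ennreal (product_density gs x))"
abbreviation "\<nu> \<equiv> density lborel (\<lambda>x. ennreal (chi x))"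
abbreviation "H k \<equiv> cdf (density lborel (\<lambda>x. ennreal (gs k x)))"

lemma g_measurable [measurable]: "product_density gs \<in> borel_measurable borel"
  using gs by (rule product_density_measurable)

lemma chi_measurable [measurable]: "chi \<in> borel_measurable borel"
  using chi unfolding prob_density_def by simp

lemma chi_nonneg: "0 \<le> chi x"
  using chi unfolding prob_density_def by simp

lemma g_nonneg: "0 \<le> product_density gs x"
  using gs by (rule product_density_nonneg)

lemma marginal_measurable [measurable]: "H k \<in> borel_measurable borel"
  using real_distribution.cdf_borel_measurable[OF prob_density_real_distribution[OF gs]] .

sublocale \<nu>: prob_space \<nu>
  using chi by (rule prob_density_prob_space)

sublocale \<gamma>: prob_space \<gamma>
proof (rule prob_spaceI)
  have "emeasure \<gamma> {x. \<forall>k. x $ k \<in> UNIV} = (\<Prod>k\<in>UNIV. emeasure (density lborel (\<lambda>x. ennreal (gs k x))) UNIV)"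
    by (rule emeasure_product_density_box[OF gs]) auto
  also have "\<dots> = 1"
    using prob_space.emeasure_space_1[OF prob_density_prob_space[OF gs]] by simp
  finally show "emeasure \<gamma> (space \<gamma>) = 1" by simp
qed

lemma nu_null_if_gamma_null:
  assumes "A \<in> sets borel" "emeasure \<gamma> A = 0"
  shows "emeasure \<nu> A = 0"
proof -
  have [measurable]: "A \<in> sets borel" by fact
  have "AE x in lborel. ennreal (product_density gs x) * indicator A x = 0"
    using assms(2) by (simp add: emeasure_density nn_integral_0_iff_AE)
  with chi_ac have "AE x in lborel. ennreal (chi x) * indicator A x = 0"
  proof eventually_elim
    case (elim x)
    then show ?case using g_nonneg[of x] by (auto simp: indicator_def ennreal_eq_0_iff split: if_splits)
  qed
  then show ?thesis by (simp add: emeasure_density nn_integral_0_iff_AE)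
qed

lemma gamma_le_nu: "A \<in> sets borel \<Longrightarrow> c * measure \<gamma> A \<le> measure \<nu> A"
proof -
  assume [measurable]: "A \<in> sets borel"
  have "ennreal c * emeasure \<gamma> A = (\<integral>\<^sup>+x. ennreal c * (ennreal (product_density gs x) * indicator A x) \<partial>lborel)"
    by (simp add: emeasure_density nn_integral_cmult)
  also have "\<dots> \<le> (\<integral>\<^sup>+x. ennreal (chi x) * indicator A x \<partial>lborel)"
  proof (rule nn_integral_mono_AE)
    show "AE x in lborel. ennreal c * (ennreal (product_density gs x) * indicator A x) \<le> ennreal (chi x) * indicator A x"
      using chi_ge
    proof eventually_elim
      case (elim x)
      then have "ennreal c * ennreal (product_density gs x) \<le> ennreal (chi x)"
        using c_pos g_nonneg by (simp flip: ennreal_mult add: ennreal_leI)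
      then show ?case by (auto simp: indicator_def)
    qed
  qed
  also have "\<dots> = emeasure \<nu> A" by (simp add: emeasure_density)
  finally show ?thesis
    using c_pos by (simp add: \<gamma>.emeasure_eq_measure \<nu>.emeasure_eq_measure flip: ennreal_mult)
qed

text \<open>Under \<gamma> the coordinates are independent and each side of a stratum is an interval
  between consecutive quantiles, of mass \<open>1 / I\<close>.\<close>

lemma gamma_stratum:
  assumes i: "i \<in> strata_indices I"
  shows "measure \<gamma> (stratum gs I i) = (1 / real I) ^ CARD('m)"
proof -
  let ?A = "\<lambda>k. {x. quantile (gs k) ((real (i k) - 1) / real I) < ereal x \<and> ereal x \<le> quantile (gs k) (real (i k) / real I)}"
  have A: "emeasure (density lborel (\<lambda>x. ennreal (gs k x))) (?A k) = ennreal (1 / real I)" for k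
  proof -
    interpret k: prob_space "density lborel (\<lambda>x. ennreal (gs k x))"
      using gs by (rule prob_density_prob_space)
    have "1 \<le> i k" "i k \<le> I" using i unfolding strata_indices_def by auto
    then have "measure (density lborel (\<lambda>x. ennreal (gs k x))) (?A k) =
        real (i k) / real I - (real (i k) - 1) / real I"
      by (intro measure_quantile_cell[OF gs]) (auto simp: divide_right_mono)
    then show ?thesis by (simp add: k.emeasure_eq_measure flip: diff_divide_distrib)
  qed
  have "emeasure \<gamma> {x. \<forall>k. x $ k \<in> ?A k} = (\<Prod>k\<in>UNIV. emeasure (density lborel (\<lambda>x. ennreal (gs k x))) (?A k))"
    by (rule emeasure_product_density_box[OF gs]) measurable
  also have "\<dots> = ennreal ((1 / real I) ^ CARD('m))"
    unfolding A by (simp add: ennreal_power)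
  also have "{x. \<forall>k. x $ k \<in> ?A k} = stratum gs I i" unfolding stratum_def by simp
  finally show ?thesis by (simp add: \<gamma>.emeasure_eq_measure)
qed

text \<open>The bound is the same for all strata, so all of them receive many draws at once when
  \<open>M\<close> is large compared with \<open>I ^ m\<close>.\<close>

lemma nu_stratum_ge:
  assumes "i \<in> strata_indices I"
  shows "c / real I ^ CARD('m) \<le> measure \<nu> (stratum gs I i)"
  using gamma_le_nu[OF stratum_measurable, of gs I i] gamma_stratum[OF assms] by (simp add: power_divide)

text \<open>The strata are \<open>I ^ m\<close> disjoint sets of \<gamma>-mass
  \<open>1 / I ^ m\<close> each, so their complement is \<gamma>-null and hence \<nu>-null; no
  description of the uncovered points is required.\<close>

lemma nu_strata_cover:
  assumes "I \<ge> 1"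
  shows "measure \<nu> (\<Union>i\<in>strata_indices I. stratum gs I i) = 1"
proof -
  let ?U = "\<Union>i\<in>strata_indices I. stratum gs I i"
  have U[measurable]: "?U \<in> sets borel"
    using finite_strata_indices by (intro sets.finite_UN) auto
  have "measure \<gamma> ?U = (\<Sum>i\<in>strata_indices I. measure \<gamma> (stratum gs I i))"
    using disjoint_strata finite_strata_indices by (intro \<gamma>.finite_measure_finite_Union) auto
  also have "\<dots> = real (I ^ CARD('m)) * (1 / real I) ^ CARD('m)"
    using gamma_stratum by (simp add: card_strata_indices)
  also have "\<dots> = 1" using assms by (simp add: power_divide)
  finally have "measure \<gamma> (space \<gamma> - ?U) = 0"
    by (subst \<gamma>.prob_compl) auto
  then have "emeasure \<nu> (UNIV - ?U) = 0"
    by (intro nu_null_if_gamma_null) (auto simp: \<gamma>.emeasure_eq_measure)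
  then have "measure \<nu> (space \<nu> - ?U) = 0" by (simp add: measure_def)
  then show ?thesis by (subst (asm) \<nu>.prob_compl) auto
qed

lemma cell_family_strata: "cell_family \<nu> (strata_indices I) (stratum gs I)"
  using finite_strata_indices disjoint_strata \<nu>.prob_space_axioms
  by (intro cell_family.intro cell_family_axioms.intro) auto

section \<open>Strata cut by the boundary of an orthant\<close>

lemma marginal_level_null: "emeasure \<nu> {x. H k (x $ k) = H k b} = 0"
proof -
  interpret k: real_distribution "density lborel (\<lambda>x. ennreal (gs k x))"
    using gs by (rule prob_density_real_distribution)
  \<comment> \<open>The coordinates are independent under \<gamma>, but not in general under \<nu>.
    The level set is therefore measured as a box under \<gamma>, and its nullity is carried over by
    absolute continuity.\<close>
  let ?A = "\<lambda>j. if j = k then {x. H k x = H k b} else UNIV"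
  have "measure (density lborel (\<lambda>x. ennreal (gs k x))) {x. H k x = H k b} = 0"
    using prob_density_isCont_cdf[OF gs] by (intro k.measure_cdf_eq) (auto simp: cdf_def)
  then have "emeasure (density lborel (\<lambda>x. ennreal (gs k x))) (?A k) = 0"
    by (simp add: k.emeasure_eq_measure)
  then have "(\<Prod>j\<in>UNIV. emeasure (density lborel (\<lambda>x. ennreal (gs j x))) (?A j)) = 0"
    by (intro prod_zero) auto
  then have "emeasure \<gamma> {x. \<forall>j. x $ j \<in> ?A j} = 0"
    by (subst emeasure_product_density_box[OF gs]) auto
  moreover have "{x. \<forall>j. x $ j \<in> ?A j} = {x. H k (x $ k) = H k b}" by auto
  ultimately show ?thesis by (intro nu_null_if_gamma_null) auto
qed

text \<open>Distance is measured between ranks: in that scale every side of a stratum has length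
  \<open>1 / I\<close>, whereas in the original coordinates it may be unbounded.\<close>

definition near :: "real^'m \<Rightarrow> nat \<Rightarrow> (real^'m) set" where
  "near a I = {x. \<exists>k. \<bar>H k (x $ k) - H k (a $ k)\<bar> \<le> 1 / real I}"

lemma near_measurable [measurable]: "near a I \<in> sets borel"
  unfolding near_def by measurable

definition near_coord :: "real^'m \<Rightarrow> 'm \<Rightarrow> nat \<Rightarrow> (real^'m) set" where
  "near_coord a k I = {x. \<bar>H k (x $ k) - H k (a $ k)\<bar> \<le> 1 / real I}"

lemma near_coord_measurable [measurable]: "near_coord a k I \<in> sets borel"
  unfolding near_coord_def by measurable

text \<open>Continuity from above: the slabs shrink to a level set of the marginal distribution
  function, which is null. The index \<open>Suc n\<close> avoids \<open>1 / 0 = 0\<close>, which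
  would spoil monotonicity.\<close>

lemma nu_near_coord_tendsto: "(\<lambda>n. measure \<nu> (near_coord a k (Suc n))) \<longlonglongrightarrow> 0"
proof -
  have "(\<lambda>n. measure \<nu> (near_coord a k (Suc n))) \<longlonglongrightarrow> measure \<nu> (\<Inter>n. near_coord a k (Suc n))"
  proof (rule \<nu>.finite_Lim_measure_decseq)
    show "decseq (\<lambda>n. near_coord a k (Suc n))"
      unfolding decseq_def near_coord_def
    proof (intro allI impI subsetI CollectI)
      fix m n :: nat and x assume mn: "m \<le> n" and x: "x \<in> {x. \<bar>H k (x $ k) - H k (a $ k)\<bar> \<le> 1 / real (Suc n)}"
      have "1 / real (Suc n) \<le> 1 / real (Suc m)"
        using mn by (intro divide_left_mono) auto
      with x[THEN CollectD] show "\<bar>H k (x $ k) - H k (a $ k)\<bar> \<le> 1 / real (Suc m)"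
        by (rule order_trans)
    qed
    show "range (\<lambda>n. near_coord a k (Suc n)) \<subseteq> sets \<nu>"
      by auto
  qed
  also have "(\<Inter>n. near_coord a k (Suc n)) = {x. H k (x $ k) = H k (a $ k)}"
  proof (intro set_eqI iffI)
    fix x assume x: "x \<in> (\<Inter>n. near_coord a k (Suc n))"
    have "\<bar>H k (x $ k) - H k (a $ k)\<bar> \<le> 0"
    proof (rule LIMSEQ_le_const)
      show "(\<lambda>n. 1 / real (Suc n)) \<longlonglongrightarrow> 0"
        using LIMSEQ_inverse_real_of_nat by (simp only: inverse_eq_divide)
      show "\<exists>N. \<forall>n\<ge>N. \<bar>H k (x $ k) - H k (a $ k)\<bar> \<le> 1 / real (Suc n)"
        using x unfolding near_coord_def by blast
    qed
    then show "x \<in> {x. H k (x $ k) = H k (a $ k)}" by simp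
  next
    fix x assume "x \<in> {x. H k (x $ k) = H k (a $ k)}"
    then show "x \<in> (\<Inter>n. near_coord a k (Suc n))" unfolding near_coord_def by simp
  qed
  also have "measure \<nu> \<dots> = 0" using marginal_level_null by (simp add: measure_def)
  finally show ?thesis .
qed

lemma nu_near_tendsto: "(\<lambda>n. measure \<nu> (near a (Suc n))) \<longlonglongrightarrow> 0"
proof (rule tendsto_sandwich[OF _ _ tendsto_const])
  show "\<forall>\<^sub>F n in sequentially. 0 \<le> measure \<nu> (near a (Suc n))"
    by simp
  show "\<forall>\<^sub>F n in sequentially. measure \<nu> (near a (Suc n)) \<le> (\<Sum>k\<in>UNIV. measure \<nu> (near_coord a k (Suc n)))"
  proof (intro always_eventually allI)
    fix n
    have "near a (Suc n) = (\<Union>k\<in>UNIV. near_coord a k (Suc n))"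
      unfolding near_def near_coord_def by blast
    also have "measure \<nu> \<dots> \<le> (\<Sum>k\<in>UNIV. measure \<nu> (near_coord a k (Suc n)))"
      by (rule \<nu>.finite_measure_subadditive_finite) auto
    finally show "measure \<nu> (near a (Suc n)) \<le> (\<Sum>k\<in>UNIV. measure \<nu> (near_coord a k (Suc n)))" .
  qed
  show "(\<lambda>n. \<Sum>k\<in>UNIV. measure \<nu> (near_coord a k (Suc n))) \<longlonglongrightarrow> 0"
    by (rule tendsto_null_sum) (rule nu_near_coord_tendsto)
qed

text \<open>If a stratum has a point \<open>x \<le> a\<close> and a point \<open>y\<close> with
  \<open>y $ k > a $ k\<close>, then \<open>a $ k\<close> lies in its side \<open>k\<close>. All
  ranks on this side differ from that of \<open>a $ k\<close> by at most \<open>1 / I\<close>, so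
  the whole stratum is near \<open>a\<close>.\<close>

lemma stratum_cut:
  "stratum gs I i \<subseteq> {..a} \<or> stratum gs I i \<inter> {..a} = {} \<or> stratum gs I i \<subseteq> near a I"
proof -
  have "stratum gs I i \<subseteq> {..a}"
    if "\<not> stratum gs I i \<subseteq> near a I" "\<not> stratum gs I i \<inter> {..a} = {}"
  proof -
    from that obtain x z where x: "x \<in> stratum gs I i" "x \<le> a" and z: "z \<in> stratum gs I i" "z \<notin> near a I"
      by auto
    show "stratum gs I i \<subseteq> {..a}"
    proof
      fix y assume y: "y \<in> stratum gs I i"
      have "y $ k \<le> a $ k" for k
      proof (rule ccontr)
        assume "\<not> y $ k \<le> a $ k"
        let ?u = "(real (i k) - 1) / real I" and ?v = "real (i k) / real I"
        have bnd: "?u \<le> H k w \<and> H k w \<le> ?v"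
          if "quantile (gs k) ?u < ereal w" "ereal w \<le> quantile (gs k) ?v" for w
          using that by (intro conjI le_cdf_if_quantile_less[OF gs] cdf_le_if_le_quantile[OF gs]) auto
        have cell: "quantile (gs k) ?u < ereal (w $ k) \<and> ereal (w $ k) \<le> quantile (gs k) ?v"
          if "w \<in> stratum gs I i" for w
          using that unfolding stratum_def by blast
        \<comment> \<open>The coordinate \<open>a $ k\<close> is caught between \<open>x $ k\<close>
          and \<open>y $ k\<close>, both in side \<open>k\<close> of the stratum.\<close>
        have "x $ k \<le> a $ k" using x(2) by (simp add: less_eq_vec_def)
        then have "quantile (gs k) ?u < ereal (a $ k)"
          using cell[OF x(1)] by (meson ereal_less_eq(3) less_le_trans)
        moreover have "ereal (a $ k) \<le> quantile (gs k) ?v"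
          using cell[OF y] \<open>\<not> y $ k \<le> a $ k\<close> by (meson ereal_less_eq(3) linear order_trans)
        ultimately have "?u \<le> H k (a $ k) \<and> H k (a $ k) \<le> ?v" by (rule bnd)
        moreover have "?u \<le> H k (z $ k) \<and> H k (z $ k) \<le> ?v" using cell[OF z(1)] bnd by blast
        ultimately have "\<bar>H k (z $ k) - H k (a $ k)\<bar> \<le> ?v - ?u" by linarith
        also have "?v - ?u = 1 / real I" by (simp flip: diff_divide_distrib)
        finally show False using z(2) unfolding near_def by blast
      qed
      then show "y \<in> {..a}" by (simp add: less_eq_vec_def)
    qed
  qed
  then show ?thesis by blast
qed

lemma borel_generator_atMost:
  "Int_stable (range (\<lambda>a::real^'m. {..a}))"
  "range (\<lambda>a::real^'m. {..a}) \<subseteq> Pow (space \<nu>)"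
  "sets \<nu> = sigma_sets (space \<nu>) (range (\<lambda>a. {..a}))"
proof -
  show "Int_stable (range (\<lambda>a::real^'m. {..a}))"
  proof (rule Int_stableI)
    fix A B :: "(real^'m) set" assume "A \<in> range (\<lambda>a. {..a})" "B \<in> range (\<lambda>a. {..a})"
    then obtain a b where ab: "A = {..a}" "B = {..b}" by blast
    have "{..a} \<inter> {..b} = {..inf a b}" by (simp only: set_eq_iff Int_iff atMost_iff le_inf_iff) simp
    with ab show "A \<inter> B \<in> range (\<lambda>a. {..a})" by blast
  qed
  have "sets (borel :: (real^'m) measure) = sigma_sets UNIV (range (\<lambda>a. {..a}))"
    by (subst borel_eq_atMost, rule sets_measure_of) (simp only: Pow_UNIV subset_UNIV)
  then show "sets \<nu> = sigma_sets (space \<nu>) (range (\<lambda>a. {..a}))"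
    by (simp only: sets_density sets_lborel space_density space_lborel space_borel)
  show "range (\<lambda>a::real^'m. {..a}) \<subseteq> Pow (space \<nu>)"
    by (simp only: space_density space_lborel space_borel Pow_UNIV subset_UNIV)
qed

text \<open>From index 1 on the residual is exactly 0, by the cut bound with the empty exceptional
  set. Index 0 has no strata at all and is shifted away.\<close>

lemma residual_space_tendsto:
  "(\<lambda>n. cell_family.residual \<nu> (strata_indices n) (stratum gs n) (indicator UNIV)) \<longlonglongrightarrow> 0"
proof -
  have le: "cell_family.residual \<nu> (strata_indices (Suc n)) (stratum gs (Suc n)) (indicator UNIV) \<le> measure \<nu> {}" for n
    by (rule cell_family.residual_indicator_le[OF cell_family_strata]) (simp_all add: nu_strata_cover)
  have ge: "0 \<le> cell_family.residual \<nu> (strata_indices (Suc n)) (stratum gs (Suc n)) (indicator UNIV)" for n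
    by (rule cell_family.residual_nonneg[OF cell_family_strata \<nu>.square_integrable_indicator]) simp
  have "cell_family.residual \<nu> (strata_indices (Suc n)) (stratum gs (Suc n)) (indicator UNIV) = 0" for n
    using le[of n] ge[of n] unfolding measure_empty by (rule order_antisym)
  then show ?thesis by - (rule LIMSEQ_imp_Suc, simp)
qed

lemma residual_atMost_tendsto:
  "(\<lambda>n. cell_family.residual \<nu> (strata_indices n) (stratum gs n) (indicator {..a})) \<longlonglongrightarrow> 0"
proof (rule LIMSEQ_imp_Suc, rule tendsto_sandwich[OF _ _ tendsto_const nu_near_tendsto])
  show "\<forall>\<^sub>F n in sequentially. 0 \<le>
      cell_family.residual \<nu> (strata_indices (Suc n)) (stratum gs (Suc n)) (indicator {..a})"
  proof (intro always_eventually allI)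
    show "0 \<le> cell_family.residual \<nu> (strata_indices (Suc n)) (stratum gs (Suc n)) (indicator {..a})" for n
      by (rule cell_family.residual_nonneg[OF cell_family_strata \<nu>.square_integrable_indicator]) simp
  qed
  show "\<forall>\<^sub>F n in sequentially.
      cell_family.residual \<nu> (strata_indices (Suc n)) (stratum gs (Suc n)) (indicator {..a})
      \<le> measure \<nu> (near a (Suc n))"
  proof (intro always_eventually allI)
    show "cell_family.residual \<nu> (strata_indices (Suc n)) (stratum gs (Suc n)) (indicator {..a})
        \<le> measure \<nu> (near a (Suc n))" for n
      using stratum_cut[of "Suc n" _ a]
      by (intro cell_family.residual_indicator_le[OF cell_family_strata]) (simp_all add: nu_strata_cover)
  qed
qed

lemma cell_family_sequence_strata:
  "cell_family_sequence \<nu> strata_indices (stratum gs) (range (\<lambda>a. {..a}))"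
proof (rule cell_family_sequence.intro[OF cell_family_strata borel_generator_atMost])
  fix A :: "(real^'m) set" assume "A \<in> insert (space \<nu>) (range (\<lambda>a. {..a}))"
  then consider "A = UNIV" | a where "A = {..a}" by auto
  then show "(\<lambda>n. cell_family.residual \<nu> (strata_indices n) (stratum gs n) (indicator A)) \<longlonglongrightarrow> 0"
    using residual_space_tendsto residual_atMost_tendsto by cases simp_all
qed

lemmas strata_form_tendsto = cell_family_sequence.cell_form_tendsto[OF cell_family_sequence_strata]

end

section \<open>Conditional moments and proportional allocation\<close>

lemma (in prob_space) finite_measure_subalgebra_vimage:
  assumes X: "X \<in> borel_measurable M"
  shows "finite_measure_subalgebra M (vimage_algebra (space M) X borel)"
proof (intro finite_measure_subalgebra.intro finite_measure_subalgebra_axioms.intro)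
  show "finite_measure M" by unfold_locales
  show "subalgebra M (vimage_algebra (space M) X borel)"
    using X unfolding subalgebra_def by (simp add: sets_image_in_sets)
qed

text \<open>The event that \<open>X\<close> lies in \<open>S\<close> belongs to the conditioning
  sigma-algebra, so \<open>Z\<close> may be replaced by its conditional expectation there; the law
  of \<open>X\<close> then turns the integral into one over \<open>lborel\<close>.\<close>

lemma (in prob_space) cond_exp_given_integral:
  assumes X[measurable]: "X \<in> borel_measurable M" and Z: "integrable M Z"
    and xi: "is_cond_exp_given M X Z \<xi>"
    and dens: "distributed M lborel X (\<lambda>x. ennreal (f x))" "\<And>x. 0 \<le> f x"
    and S[measurable]: "S \<in> sets borel"
  shows "(\<integral>\<omega>. indicator S (X \<omega>) * Z \<omega> \<partial>M) = (LINT x:S|lborel. \<xi> x * f x)"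
proof -
  let ?F = "vimage_algebra (space M) X borel"
  interpret finite_measure_subalgebra M ?F
    using X by (rule finite_measure_subalgebra_vimage)
  have [measurable]: "\<xi> \<in> borel_measurable borel" using xi unfolding is_cond_exp_given_def by simp
  let ?A = "X -` S \<inter> space M"
  have "(\<integral>\<omega>. indicator S (X \<omega>) * Z \<omega> \<partial>M) = (\<integral>\<omega>\<in>?A. Z \<omega> \<partial>M)"
    unfolding set_lebesgue_integral_def
    by (intro Bochner_Integration.integral_cong refl) (simp add: indicator_def)
  also have "\<dots> = (\<integral>\<omega>\<in>?A. real_cond_exp M ?F Z \<omega> \<partial>M)"
    using Z by (intro real_cond_exp_intA in_vimage_algebra) auto
  also have "\<dots> = (\<integral>\<omega>. indicator S (X \<omega>) * \<xi> (X \<omega>) \<partial>M)"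
    unfolding set_lebesgue_integral_def
  proof (rule integral_cong_AE)
    show "(\<lambda>\<omega>. indicat_real ?A \<omega> *\<^sub>R real_cond_exp M ?F Z \<omega>) \<in> borel_measurable M"
      by measurable
    show "(\<lambda>\<omega>. indicator S (X \<omega>) * \<xi> (X \<omega>)) \<in> borel_measurable M" by measurable
    show "AE \<omega> in M. indicat_real ?A \<omega> *\<^sub>R real_cond_exp M ?F Z \<omega> = indicator S (X \<omega>) * \<xi> (X \<omega>)"
      using xi[unfolded is_cond_exp_given_def, THEN conjunct2] AE_space
      by eventually_elim (simp add: indicator_def)
  qed
  also have "\<dots> = (\<integral>x. f x * (indicator S x * \<xi> x) \<partial>lborel)"
    using dens by (intro distributed_integral[symmetric]) auto
  also have "\<dots> = (LINT x:S|lborel. \<xi> x * f x)"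
    unfolding set_lebesgue_integral_def by (simp add: mult_ac)
  finally show ?thesis .
qed

text \<open>Conditional Jensen for the square, transported to the law of \<open>X\<close>. Versions
  of conditional moments are determined only up to null sets of this law, whence the restriction to
  \<open>0 < f x\<close>.\<close>

lemma (in prob_space) cond_exp_given_square_le:
  assumes X[measurable]: "X \<in> borel_measurable M"
    and Z: "integrable M Z" "integrable M (\<lambda>\<omega>. (Z \<omega>)\<^sup>2)"
    and psi: "is_cond_exp_given M X Z \<psi>" and zeta: "is_cond_exp_given M X (\<lambda>\<omega>. (Z \<omega>)\<^sup>2) \<zeta>"
    and dens: "distributed M lborel X (\<lambda>x. ennreal (f x))" "f \<in> borel_measurable borel"
  shows "AE x in lborel. 0 < f x \<longrightarrow> (\<psi> x)\<^sup>2 \<le> \<zeta> x"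
proof -
  let ?F = "vimage_algebra (space M) X borel"
  interpret finite_measure_subalgebra M ?F
    using X by (rule finite_measure_subalgebra_vimage)
  have [measurable]: "\<psi> \<in> borel_measurable borel" "\<zeta> \<in> borel_measurable borel" "f \<in> borel_measurable borel"
    using psi zeta dens unfolding is_cond_exp_given_def by simp_all
  have "AE \<omega> in M. (real_cond_exp M ?F Z \<omega>)\<^sup>2 \<le> real_cond_exp M ?F (\<lambda>\<omega>. (Z \<omega>)\<^sup>2) \<omega>"
    using Z by (intro real_cond_exp_jensens_inequality(2)[where I = UNIV]) (auto simp: convex_power2)
  with psi[unfolded is_cond_exp_given_def, THEN conjunct2] zeta[unfolded is_cond_exp_given_def, THEN conjunct2]
  have "AE \<omega> in M. (\<psi> (X \<omega>))\<^sup>2 \<le> \<zeta> (X \<omega>)" by eventually_elim simp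
  then have "AE x in distr M lborel X. (\<psi> x)\<^sup>2 \<le> \<zeta> x"
    by (subst AE_distr_iff) auto
  then have "AE x in density lborel (\<lambda>x. ennreal (f x)). (\<psi> x)\<^sup>2 \<le> \<zeta> x"
    unfolding distributed_distr_eq_density[OF dens(1)] .
  then show ?thesis by (subst (asm) AE_density) auto
qed

text \<open>The variance is the second moment minus the squared mean under the conditional law. For
  a null event there is no conditional probability measure, but both sides vanish.\<close>

lemma (in prob_space) prob_square_cond_variance:
  assumes A[measurable]: "A \<in> events" and Z: "integrable M Z" "integrable M (\<lambda>\<omega>. (Z \<omega>)\<^sup>2)"
  shows "(prob A)\<^sup>2 * cond_variance M A Z =
    prob A * (\<integral>\<omega>. indicator A \<omega> * (Z \<omega>)\<^sup>2 \<partial>M) - (\<integral>\<omega>. indicator A \<omega> * Z \<omega> \<partial>M)\<^sup>2"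
proof (cases "prob A = 0")
  case True
  then have "AE \<omega> in M. indicator A \<omega> * Z \<omega> = 0"
    using AE_not_in[of A M] by (auto simp: null_sets_def emeasure_eq_measure)
  then have "(\<integral>\<omega>. indicator A \<omega> * Z \<omega> \<partial>M) = 0" by (rule integral_eq_zero_AE)
  then show ?thesis using True by simp
next
  case False
  then have pos: "prob A > 0" by (simp add: zero_less_measure_iff)
  define U where "U = uniform_measure M A"
  have U: "U = density M (\<lambda>\<omega>. ennreal (indicator A \<omega> / prob A))"
    unfolding U_def uniform_measure_def using pos
    by (intro arg_cong[where f = "density M"] ext)
       (simp add: emeasure_eq_measure divide_ennreal ennreal_indicator[symmetric])
  interpret U: prob_space U
    unfolding U_def using False by (intro prob_space_uniform_measure) (auto simp: emeasure_eq_measure)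
  have int: "integrable U h" "(\<integral>\<omega>. h \<omega> \<partial>U) = (\<integral>\<omega>. indicator A \<omega> * h \<omega> \<partial>M) / prob A"
    if h: "integrable M h" for h :: "'a \<Rightarrow> real"
  proof -
    have [measurable]: "h \<in> borel_measurable M" using h by simp
    have i: "integrable M (\<lambda>\<omega>. indicator A \<omega> *\<^sub>R h \<omega>)"
      using A h by (rule integrable_mult_indicator)
    have eq: "(indicator A \<omega> / prob A) * h \<omega> = (1 / prob A) * (indicator A \<omega> * h \<omega>)" for \<omega>
      by simp
    show "integrable U h"
      unfolding U using i
      by (subst integrable_real_density) (auto simp: eq simp del: times_divide_eq_left)
    have "(\<integral>\<omega>. h \<omega> \<partial>U) = (\<integral>\<omega>. (1 / prob A) * (indicator A \<omega> * h \<omega>) \<partial>M)"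
      unfolding U by (subst integral_real_density) (auto simp: eq simp del: times_divide_eq_left)
    then show "(\<integral>\<omega>. h \<omega> \<partial>U) = (\<integral>\<omega>. indicator A \<omega> * h \<omega> \<partial>M) / prob A" by simp
  qed
  have "cond_variance M A Z = (\<integral>\<omega>. (Z \<omega>)\<^sup>2 \<partial>U) - (\<integral>\<omega>. Z \<omega> \<partial>U)\<^sup>2"
    unfolding cond_variance_def U_def[symmetric]
    using int(1)[OF Z(1)] int(1)[OF Z(2)] by (rule U.variance_eq)
  then show ?thesis
    using pos unfolding int(2)[OF Z(1)] int(2)[OF Z(2)]
    by (simp add: right_diff_distrib power_divide power2_eq_square)
qed

lemma (in prob_space) prob_square_cond_variance_nonneg: "0 \<le> (prob A)\<^sup>2 * cond_variance M A Z"
  unfolding cond_variance_def by (auto intro!: mult_nonneg_nonneg Bochner_Integration.integral_nonneg)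

section \<open>Rounding of the draw counts\<close>

lemma draws_diff_less:
  assumes r: "linear_order_on (strata_indices I) r" and i: "i \<in> strata_indices I"
  shows "\<bar>real_of_int (draws r I q M i) - real M * q i\<bar> < 1"
proof -
  have ii: "(i, i) \<in> r"
    using r i unfolding linear_order_on_def partial_order_on_def preorder_on_def refl_on_def by blast
  let ?L = "{j. j \<in> strata_indices I \<and> (j, i) \<in> r \<and> j \<noteq> i}"
  have "{j. j \<in> strata_indices I \<and> (j, i) \<in> r} = insert i ?L" using ii i by auto
  moreover have "finite ?L" by (rule finite_subset[OF _ finite_strata_indices]) blast
  ultimately have "(\<Sum>j | j \<in> strata_indices I \<and> (j, i) \<in> r. q j) = q i + (\<Sum>j\<in>?L. q j)" by simp
  then have D: "draws r I q M i = \<lfloor>real M * q i + real M * (\<Sum>j\<in>?L. q j)\<rfloor> - \<lfloor>real M * (\<Sum>j\<in>?L. q j)\<rfloor>"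
    unfolding draws_def by (simp add: distrib_left)
  \<comment> \<open>The order affects only the offset \<open>y\<close>; the bound on the difference
    of floors does not depend on it.\<close>
  have floors: "\<bar>real_of_int (\<lfloor>x + y\<rfloor> - \<lfloor>y\<rfloor>) - x\<bar> < 1" for x y :: real
    by linarith
  show ?thesis unfolding D by (rule floors)
qed

text \<open>The relative error is \<open>(M * q - D) / D\<close>, whose numerator is below 1 in
  absolute value while \<open>D \<ge> t - 1\<close>. Stating the bound through a lower bound
  \<open>t\<close> of \<open>M * q\<close> makes it uniform over strata.\<close>

lemma quotient_rounding_error:
  fixes D :: int and s q t M :: real
  assumes D: "\<bar>real_of_int D - M * q\<bar> < 1" and t: "1 < t" "t \<le> M * q" and q: "q > 0" and s: "0 \<le> s"
  shows "0 < D" "\<bar>M * (s / real_of_int D) - s / q\<bar> \<le> s / q * (1 / (t - 1))"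
proof -
  have Dt: "t - 1 \<le> real_of_int D" using D t by linarith
  then have D0: "0 < real_of_int D" using t by linarith
  then show "0 < D" by simp
  have "M * (s / real_of_int D) - s / q = s / q * ((M * q - real_of_int D) / real_of_int D)"
    using D0 q by (simp add: field_simps)
  then have "\<bar>M * (s / real_of_int D) - s / q\<bar> = s / q * (\<bar>M * q - real_of_int D\<bar> / real_of_int D)"
    using D0 q s by (simp add: abs_mult)
  also have "\<dots> \<le> s / q * (1 / (t - 1))"
    using D D0 Dt t s q by (intro mult_left_mono frac_le) auto
  finally show "\<bar>M * (s / real_of_int D) - s / q\<bar> \<le> s / q * (1 / (t - 1))" .
qed

context strata_density
begin

lemma allocation_eq: "allocation gs chi I i = measure \<nu> (stratum gs I i)"
proof -
  have "emeasure \<nu> (stratum gs I i) = (\<integral>\<^sup>+x. ennreal (indicator (stratum gs I i) x * chi x) \<partial>lborel)"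
    by (simp add: emeasure_density ennreal_mult' chi_nonneg ennreal_indicator mult.commute)
  then show ?thesis
    unfolding allocation_def set_lebesgue_integral_def measure_def
    by (subst integral_eq_nn_integral) (auto simp: chi_nonneg)
qed

text \<open>The relative error bound is common to all strata and factors out of the sum, so the
  number of strata enters only through the smallest expected count.\<close>

lemma proportional_sum_error:
  assumes r: "linear_order_on (strata_indices I) r" and s: "\<And>i. 0 \<le> s i"
    and large: "1 < real M * c / real I ^ CARD('m)"
  shows "\<bar>real M * (\<Sum>i | i \<in> strata_indices I \<and> draws r I (allocation gs chi I) M i > 0.
            s i / real_of_int (draws r I (allocation gs chi I) M i))
          - (\<Sum>i\<in>strata_indices I. s i / measure \<nu> (stratum gs I i))\<bar>
    \<le> (\<Sum>i\<in>strata_indices I. s i / measure \<nu> (stratum gs I i)) *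
        (1 / (real M * c / real I ^ CARD('m) - 1))"
proof -
  let ?J = "strata_indices I :: ('m \<Rightarrow> nat) set"
  define D where "D = draws r I (allocation gs chi I) M"
  define q where "q = (\<lambda>i. measure \<nu> (stratum gs I i))"
  define t where "t = real M * c / real I ^ CARD('m)"
  \<comment> \<open>For \<open>I = 0\<close> the quotient in \<open>large\<close> would be a
    division by 0, hence 0.\<close>
  have "I \<noteq> 0"
  proof
    assume "I = 0"
    then show False using large by (simp add: power_0_left)
  qed
  then have I: "0 < real I ^ CARD('m)" by simp
  have q: "q i > 0" "t \<le> real M * q i" if "i \<in> ?J" for i
  proof -
    have ge: "c / real I ^ CARD('m) \<le> q i"
      using nu_stratum_ge[OF that] unfolding q_def .
    then show "q i > 0" using c_pos I by (meson divide_pos_pos less_le_trans)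
    show "t \<le> real M * q i"
      using mult_left_mono[OF ge, of "real M"] unfolding t_def by simp
  qed
  have D: "\<bar>real_of_int (D i) - real M * q i\<bar> < 1" if "i \<in> ?J" for i
    using draws_diff_less[OF r that, of "allocation gs chi I" M]
    unfolding D_def q_def allocation_eq .
  have t1: "1 < t" using large unfolding t_def .
  have pos: "0 < D i" if "i \<in> ?J" for i
    using D[OF that] t1 q(2)[OF that] q(1)[OF that] s[of i] by (rule quotient_rounding_error(1))
  have err: "\<bar>real M * (s i / real_of_int (D i)) - s i / q i\<bar> \<le> s i / q i * (1 / (t - 1))" if "i \<in> ?J" for i
    using D[OF that] t1 q(2)[OF that] q(1)[OF that] s[of i] by (rule quotient_rounding_error(2))
  \<comment> \<open>Every stratum receives a draw, so the restriction to positive counts drops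
    out.\<close>
  have J: "{i. i \<in> ?J \<and> D i > 0} = ?J" using pos by auto
  have "\<bar>real M * (\<Sum>i\<in>?J. s i / real_of_int (D i)) - (\<Sum>i\<in>?J. s i / q i)\<bar> =
      \<bar>\<Sum>i\<in>?J. real M * (s i / real_of_int (D i)) - s i / q i\<bar>"
    by (simp add: sum_subtractf sum_distrib_left)
  also have "\<dots> \<le> (\<Sum>i\<in>?J. \<bar>real M * (s i / real_of_int (D i)) - s i / q i\<bar>)"
    by (rule sum_abs)
  also have "\<dots> \<le> (\<Sum>i\<in>?J. s i / q i * (1 / (t - 1)))"
    using err by (rule sum_mono)
  also have "\<dots> = (\<Sum>i\<in>?J. s i / q i) * (1 / (t - 1))"
    by (rule sum_distrib_right[symmetric])
  finally show ?thesis
    using J unfolding D_def q_def t_def by (simp only:)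
qed

section \<open>From densities over Lebesgue measure to quotients over \<nu>\<close>

context
  fixes h :: "real^'m \<Rightarrow> real"
  assumes h_measurable [measurable]: "h \<in> borel_measurable borel"
    and h_sq: "(\<integral>\<^sup>+ x. ennreal ((h x)\<^sup>2) / ennreal (product_density gs x) \<partial>lborel) < \<infinity>"
begin

text \<open>Where \<open>chi\<close> vanishes so does \<open>product_density gs\<close>, by
  \<open>chi_ge\<close>; a nonzero \<open>h x\<close> would make the integrand of
  \<open>h_sq\<close> infinite there.\<close>

lemma zero_if_chi_zero: "AE x in lborel. chi x = 0 \<longrightarrow> h x = 0"
proof -
  have "AE x in lborel. ennreal ((h x)\<^sup>2) / ennreal (product_density gs x) \<noteq> \<infinity>"
    using h_sq by (intro nn_integral_PInf_AE) auto
  with chi_ge show ?thesis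
  proof eventually_elim
    case (elim x)
    show ?case
    proof
      assume "chi x = 0"
      then have "product_density gs x = 0"
        using elim(1) c_pos g_nonneg[of x] by (simp add: mult_le_0_iff)
      then show "h x = 0" using elim(2) by (cases "h x = 0") (auto simp: ennreal_div_zero)
    qed
  qed
qed

text \<open>The integral equals that of \<open>h\<^sup>2 / chi\<close> over the set where
  \<open>chi\<close> is positive, and \<open>chi \<ge> c * g\<close> bounds it by
  \<open>1 / c\<close> times the assumed one.\<close>

lemma square_integrable_quotient: "square_integrable \<nu> (\<lambda>x. h x / chi x)"
proof -
  have "(\<integral>\<^sup>+x. ennreal ((h x / chi x)\<^sup>2) \<partial>\<nu>) = (\<integral>\<^sup>+x. ennreal (chi x) * ennreal ((h x / chi x)\<^sup>2) \<partial>lborel)"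
    by (subst nn_integral_density) auto
  also have "\<dots> \<le> (\<integral>\<^sup>+x. ennreal (1 / c) * (ennreal ((h x)\<^sup>2) / ennreal (product_density gs x)) \<partial>lborel)"
  proof (rule nn_integral_mono_AE)
    show "AE x in lborel. ennreal (chi x) * ennreal ((h x / chi x)\<^sup>2)
        \<le> ennreal (1 / c) * (ennreal ((h x)\<^sup>2) / ennreal (product_density gs x))"
      using chi_ge chi_ac
    proof eventually_elim
      case (elim x)
      show ?case
      proof (cases "chi x = 0")
        case False
        then have chi0: "chi x > 0" using chi_nonneg[of x] by simp
        have g0: "product_density gs x > 0" using elim(2) False g_nonneg[of x] by (cases "product_density gs x = 0") auto
        have "chi x * (h x / chi x)\<^sup>2 = (h x)\<^sup>2 / chi x"
          using chi0 by (simp add: power2_eq_square)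
        also have "\<dots> \<le> (h x)\<^sup>2 / (c * product_density gs x)"
          using elim(1) g0 c_pos chi0 by (intro divide_left_mono) auto
        also have "\<dots> = (1 / c) * ((h x)\<^sup>2 / product_density gs x)" by simp
        finally have "ennreal (chi x * (h x / chi x)\<^sup>2) \<le> ennreal ((1 / c) * ((h x)\<^sup>2 / product_density gs x))"
          by (rule ennreal_leI)
        also have "\<dots> = ennreal (1 / c) * ennreal ((h x)\<^sup>2 / product_density gs x)"
          using c_pos g0 by (intro ennreal_mult) auto
        also have "ennreal ((h x)\<^sup>2 / product_density gs x) = ennreal ((h x)\<^sup>2) / ennreal (product_density gs x)"
          using g0 by (intro divide_ennreal[symmetric]) auto
        also have "ennreal (chi x * (h x / chi x)\<^sup>2) = ennreal (chi x) * ennreal ((h x / chi x)\<^sup>2)"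
          using chi0 by (intro ennreal_mult) auto
        finally show ?thesis .
      qed simp
    qed
  qed
  also have "\<dots> = ennreal (1 / c) * (\<integral>\<^sup>+x. ennreal ((h x)\<^sup>2) / ennreal (product_density gs x) \<partial>lborel)"
    by (intro nn_integral_cmult) auto
  also have "\<dots> < \<infinity>" using h_sq by (simp add: ennreal_mult_less_top)
  finally show ?thesis
    unfolding square_integrable_def by (auto intro: integrableI_nonneg)
qed

lemma set_integral_quotient:
  assumes S[measurable]: "S \<in> sets borel"
  shows "(LINT x:S|\<nu>. h x / chi x) = (LINT x:S|lborel. h x)"
proof -
  have "(LINT x:S|\<nu>. h x / chi x) = (\<integral>x. chi x * (indicator S x * (h x / chi x)) \<partial>lborel)"
    unfolding set_lebesgue_integral_def by (subst integral_real_density) (auto simp: chi_nonneg)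
  also have "\<dots> = (LINT x:S|lborel. h x)"
    unfolding set_lebesgue_integral_def
  proof (rule integral_cong_AE)
    show "AE x in lborel. chi x * (indicator S x * (h x / chi x)) = indicator S x *\<^sub>R h x"
      \<comment> \<open>The factor \<open>chi\<close> cancels where it is nonzero; elsewhere
        \<open>h\<close> vanishes almost everywhere.\<close>
      using zero_if_chi_zero by eventually_elim (auto simp: indicator_def)
  qed auto
  finally show ?thesis .
qed

end

end

lemma (in prob_space) prob_square_cond_variance_given:
  assumes X[measurable]: "X \<in> borel_measurable M"
    and Z: "integrable M Z" "integrable M (\<lambda>\<omega>. (Z \<omega>)\<^sup>2)"
    and psi: "is_cond_exp_given M X Z \<psi>" and zeta: "is_cond_exp_given M X (\<lambda>\<omega>. (Z \<omega>)\<^sup>2) \<zeta>"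
    and dens: "distributed M lborel X (\<lambda>x. ennreal (f x))" "\<And>x. 0 \<le> f x"
    and S[measurable]: "S \<in> sets borel"
  shows "(prob {\<omega> \<in> space M. X \<omega> \<in> S})\<^sup>2 * cond_variance M {\<omega> \<in> space M. X \<omega> \<in> S} Z =
    (LINT x:S|lborel. f x) * (LINT x:S|lborel. \<zeta> x * f x) - (LINT x:S|lborel. \<psi> x * f x)\<^sup>2"
proof -
  let ?A = "{\<omega> \<in> space M. X \<omega> \<in> S}"
  have A: "?A \<in> events" by measurable
  have ind: "(\<integral>\<omega>. indicator ?A \<omega> * W \<omega> \<partial>M) = (\<integral>\<omega>. indicator S (X \<omega>) * W \<omega> \<partial>M)" for W :: "'a \<Rightarrow> real"
    by (intro Bochner_Integration.integral_cong refl) (simp add: indicator_def)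
  have "prob ?A = (\<integral>\<omega>. indicator S (X \<omega>) \<partial>M)"
    using A ind[of "\<lambda>_. 1"] by simp
  also have "\<dots> = (\<integral>x. f x * indicator S x \<partial>lborel)"
    using dens by (intro distributed_integral[symmetric]) auto
  finally have "prob ?A = (LINT x:S|lborel. f x)"
    unfolding set_lebesgue_integral_def by (simp add: mult.commute)
  then show ?thesis
    unfolding prob_square_cond_variance[OF A Z] ind
      cond_exp_given_integral[OF X Z(1) psi dens S] cond_exp_given_integral[OF X Z(2) zeta dens S]
    by simp
qed

lemma essinf_pos_lower_bound:
  assumes g: "g \<in> borel_measurable borel" "\<And>x. 0 \<le> g x" and chi: "\<And>x. 0 \<le> chi x"
    and pos: "0 < essinf (density lborel (\<lambda>x. ennreal (g x))) (\<lambda>x. ennreal (chi x) / ennreal (g x))"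
  shows "\<exists>c>0. AE x in lborel. c * g x \<le> chi x"
proof -
  have [measurable]: "g \<in> borel_measurable borel" by fact
  obtain z where z: "z > 0" "AE x in density lborel (\<lambda>x. ennreal (g x)). z \<le> ennreal (chi x) / ennreal (g x)"
    using pos unfolding essinf_def less_Sup_iff by blast
  \<comment> \<open>The bound \<open>z\<close> may be infinite; cutting it at 1 makes it a positive
    real.\<close>
  define c where "c = enn2real (min z 1)"
  have "min z 1 < top" by (simp add: min_less_iff_disj)
  then have c: "ennreal c = min z 1" unfolding c_def by simp
  have "c > 0" unfolding c_def using z(1) by (simp add: enn2real_positive_iff min_less_iff_disj)
  have "AE x in lborel. 0 < ennreal (g x) \<longrightarrow> z \<le> ennreal (chi x) / ennreal (g x)"
    using z(2) by (subst (asm) AE_density) auto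
  then have "AE x in lborel. c * g x \<le> chi x"
  proof eventually_elim
    case (elim x)
    show ?case
    proof (cases "g x = 0")
      case False
      then have g0: "g x > 0" using g(2)[of x] by simp
      have "ennreal c \<le> z" unfolding c by simp
      also have "\<dots> \<le> ennreal (chi x) / ennreal (g x)" using elim g0 by simp
      also have "\<dots> = ennreal (chi x / g x)" using g0 chi by (intro divide_ennreal) auto
      finally have "c \<le> chi x / g x" using chi g0 by simp
      then show ?thesis using g0 by (simp add: field_simps)
    qed (use chi in simp)
  qed
  with \<open>c > 0\<close> show ?thesis by blast
qed

lemma null_where_quotient_infinite:
  assumes [measurable]: "chi \<in> borel_measurable borel" "g \<in> borel_measurable borel"
    and fin: "(\<integral>\<^sup>+ x. ennreal ((chi x)\<^sup>2) / ennreal (g x) \<partial>lborel) < \<infinity>"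
  shows "AE x in lborel. g x = 0 \<longrightarrow> chi x = 0"
proof -
  have "AE x in lborel. ennreal ((chi x)\<^sup>2) / ennreal (g x) \<noteq> \<infinity>"
    using fin by (intro nn_integral_PInf_AE) auto
  then show ?thesis
  proof eventually_elim
    case (elim x)
    then show ?case by (cases "chi x = 0") (auto simp: ennreal_div_zero)
  qed
qed

text \<open>Matches the extended nonnegative integral with a real one over \<nu>. Where
  \<open>chi\<close> is 0 so is \<open>f\<close>, hence \<open>0 / 0 = 0\<close> agrees with the
  weight 0; elsewhere Jensen makes the integrand nonnegative, so truncation changes nothing.\<close>

lemma limit_variance_eq:
  assumes [measurable]: "f \<in> borel_measurable borel" "\<psi> \<in> borel_measurable borel"
      "\<zeta> \<in> borel_measurable borel" "chi \<in> borel_measurable borel"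
    and chi: "\<And>x. 0 \<le> chi x" and f: "\<And>x. 0 \<le> f x"
    and null: "AE x in lborel. chi x = 0 \<longrightarrow> f x = 0"
    and jensen: "AE x in lborel. 0 < f x \<longrightarrow> (\<psi> x)\<^sup>2 \<le> \<zeta> x"
    and int: "integrable (density lborel (\<lambda>x. ennreal (chi x)))
      (\<lambda>x. (f x / chi x) * (\<zeta> x * f x / chi x) - (\<psi> x * f x / chi x) * (\<psi> x * f x / chi x))"
  shows "limit_variance f \<psi> \<zeta> chi = ennreal (\<integral>x. (f x / chi x) * (\<zeta> x * f x / chi x)
      - (\<psi> x * f x / chi x) * (\<psi> x * f x / chi x) \<partial>density lborel (\<lambda>x. ennreal (chi x)))"
proof -
  define k where "k = (\<lambda>x. (f x / chi x) * (\<zeta> x * f x / chi x) - (\<psi> x * f x / chi x) * (\<psi> x * f x / chi x))"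
  have [measurable]: "k \<in> borel_measurable borel" unfolding k_def by measurable
  have k: "k x = (f x)\<^sup>2 * (\<zeta> x - (\<psi> x)\<^sup>2) / (chi x)\<^sup>2" for x
    unfolding k_def by (simp add: power2_eq_square diff_divide_distrib right_diff_distrib mult_ac)
  have k0: "AE x in lborel. 0 \<le> k x"
    using jensen
  proof eventually_elim
    case (elim x)
    then show ?case using f[of x] unfolding k by (cases "f x = 0") auto
  qed
  have "limit_variance f \<psi> \<zeta> chi = (\<integral>\<^sup>+x. ennreal (chi x) * ennreal (k x) \<partial>lborel)"
    unfolding limit_variance_def
  proof (rule nn_integral_cong_AE)
    show "AE x in lborel. ennreal ((f x)\<^sup>2 * (\<zeta> x - (\<psi> x)\<^sup>2)) / ennreal (chi x) = ennreal (chi x) * ennreal (k x)"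
      using null k0
    proof eventually_elim
      case (elim x)
      show ?case
      proof (cases "chi x = 0")
        case True
        then show ?thesis using elim by (simp add: ennreal_div_zero)
      next
        case False
        then have c: "chi x > 0" using chi[of x] by simp
        have "(f x)\<^sup>2 * (\<zeta> x - (\<psi> x)\<^sup>2) = (chi x)\<^sup>2 * k x" unfolding k using c by simp
        moreover have "ennreal ((chi x)\<^sup>2 * k x) / ennreal (chi x) = ennreal ((chi x)\<^sup>2 * k x / chi x)"
          using elim(2) c by (intro divide_ennreal) auto
        moreover have "(chi x)\<^sup>2 * k x / chi x = chi x * k x" using c by (simp add: power2_eq_square)
        ultimately show ?thesis using c elim(2) by (simp add: ennreal_mult)
      qed
    qed
  qed
  also have "\<dots> = (\<integral>\<^sup>+x. ennreal (k x) \<partial>density lborel (\<lambda>x. ennreal (chi x)))"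
    by (subst nn_integral_density) auto
  also have "\<dots> = ennreal (\<integral>x. k x \<partial>density lborel (\<lambda>x. ennreal (chi x)))"
  proof (rule nn_integral_eq_integral)
    show "AE x in density lborel (\<lambda>x. ennreal (chi x)). 0 \<le> k x"
      using k0 by (subst AE_density) auto
  qed (use int in \<open>simp add: k_def\<close>)
  finally show ?thesis unfolding k_def .
qed

section \<open>The iterated limit and the joint limit\<close>

theorem proposition1:
  fixes P :: "'a measure"
    and Y :: "'a \<Rightarrow> real^'d::finite"
    and \<phi> :: "real^'d \<Rightarrow> real"
    and gs :: "'m::finite \<Rightarrow> real \<Rightarrow> real"
    and g f chi \<psi> \<zeta> :: "real^'m \<Rightarrow> real"
    and \<mu> :: "real^'m^'d"
    and r :: "nat \<Rightarrow> ('m \<Rightarrow> nat) rel"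
  assumes dim: "CARD('m) < CARD('d)"
    and P: "prob_space P"
    and Y: "Y \<in> borel_measurable P"
    and phi: "\<phi> \<in> borel_measurable borel"
    and phi_sq: "integrable P (\<lambda>\<omega>. (\<phi> (Y \<omega>))\<^sup>2)"
    and gs: "\<And>k. prob_density (gs k)"
    and g: "g = product_density gs"
    and mu: "transpose \<mu> ** \<mu> = mat 1"
    and f: "prob_density f"
      "distributed P lborel (\<lambda>\<omega>. transpose \<mu> *v Y \<omega>) (\<lambda>x. ennreal (f x))"
    and chi_density: "prob_density chi"
    and psi: "is_cond_exp_given P (\<lambda>\<omega>. transpose \<mu> *v Y \<omega>) (\<lambda>\<omega>. \<phi> (Y \<omega>)) \<psi>"
    and zeta: "is_cond_exp_given P (\<lambda>\<omega>. transpose \<mu> *v Y \<omega>) (\<lambda>\<omega>. (\<phi> (Y \<omega>))\<^sup>2) \<zeta>"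
    and ord: "\<And>I. linear_order_on (strata_indices I) (r I)"
    and A1: "(\<integral>\<^sup>+ x. ennreal ((chi x)\<^sup>2) / ennreal (g x) \<partial>lborel) < \<infinity>"
      "essinf (density lborel (\<lambda>x. ennreal (g x))) (\<lambda>x. ennreal (chi x) / ennreal (g x)) > 0"
    and A2: "\<And>h. h \<in> {f, \<lambda>x. \<zeta> x * f x, \<lambda>x. \<psi> x * f x} \<Longrightarrow>
      (\<integral>\<^sup>+ x. ennreal ((h x)\<^sup>2) / ennreal (g x) \<partial>lborel) < \<infinity>"
    and A3: "(\<integral>\<^sup>+ x. ennreal ((f x)^4 * (\<zeta> x - (\<psi> x)\<^sup>2)\<^sup>2) / ennreal ((chi x)\<^sup>2 * g x) \<partial>lborel) < \<infinity>"
  shows "(\<exists>L :: nat \<Rightarrow> real.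
            (\<forall>I\<ge>1. (\<lambda>M. real M * strat_variance P Y \<phi> r \<mu> gs (allocation gs chi) I M)
                      \<longlonglongrightarrow> L I) \<and>
            (\<lambda>I. ennreal (L I)) \<longlonglongrightarrow> limit_variance f \<psi> \<zeta> chi) \<and>
         (\<forall>IM :: nat \<Rightarrow> nat.
            (\<forall>M\<ge>1. IM M \<ge> 1) \<and>
            (esssup (density lborel (\<lambda>x. ennreal (chi x))) (\<lambda>x. ennreal (f x) / ennreal (chi x)) < \<infinity> \<and>
               (\<lambda>M. 1 / real (IM M) + real (IM M) ^ CARD('m) / real M) \<longlonglongrightarrow> 0
             \<or> (\<lambda>M. 1 / real (IM M) + real (IM M) ^ (2 * CARD('m)) / real M) \<longlonglongrightarrow> 0) \<longrightarrow>
            (\<lambda>M. ennreal (real M * strat_variance P Y \<phi> r \<mu> gs (allocation gs chi) (IM M) M))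
              \<longlonglongrightarrow> limit_variance f \<psi> \<zeta> chi)"
proof -
  interpret prob_space P by (rule P)
  define X where "X = (\<lambda>\<omega>. transpose \<mu> *v Y \<omega>)"
  define Z where "Z = (\<lambda>\<omega>. \<phi> (Y \<omega>))"
  have X: "X \<in> borel_measurable P"
    using f(2) unfolding X_def distributed_def by simp
  have Z2: "integrable P (\<lambda>\<omega>. (Z \<omega>)\<^sup>2)" using phi_sq unfolding Z_def .
  have "Z \<in> borel_measurable P" using Y phi unfolding Z_def by simp
  then have Z1: "integrable P Z" using Z2 by (rule square_integrable_imp_integrable)
  have psi': "is_cond_exp_given P X Z \<psi>" and zeta': "is_cond_exp_given P X (\<lambda>\<omega>. (Z \<omega>)\<^sup>2) \<zeta>"
    using psi zeta unfolding X_def Z_def .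
  have [measurable]: "\<psi> \<in> borel_measurable borel" "\<zeta> \<in> borel_measurable borel"
      "f \<in> borel_measurable borel" "chi \<in> borel_measurable borel"
    using psi zeta f(1) chi_density unfolding is_cond_exp_given_def prob_density_def by simp_all
  have f0: "0 \<le> f x" and chi0: "0 \<le> chi x" for x
    using f(1) chi_density unfolding prob_density_def by simp_all
  have fX: "distributed P lborel X (\<lambda>x. ennreal (f x))" using f(2) unfolding X_def .

  have g_measurable [measurable]: "g \<in> borel_measurable borel" and g_nonneg: "\<And>x. 0 \<le> g x"
    unfolding g using gs by (simp_all add: product_density_measurable product_density_nonneg)
  obtain c where c: "c > 0" "AE x in lborel. c * g x \<le> chi x"
    using essinf_pos_lower_bound[OF g_measurable g_nonneg chi0 A1(2)] by blast
  have ac: "AE x in lborel. g x = 0 \<longrightarrow> chi x = 0"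
    using A1(1) by (intro null_where_quotient_infinite) auto
  interpret D: strata_density gs chi c
    using gs chi_density c ac unfolding g by unfold_locales

  define u where "u = (\<lambda>x. f x / chi x)"
  define v where "v = (\<lambda>x. \<zeta> x * f x / chi x)"
  define w where "w = (\<lambda>x. \<psi> x * f x / chi x)"
  have A2': "(\<integral>\<^sup>+ x. ennreal ((f x)\<^sup>2) / ennreal (product_density gs x) \<partial>lborel) < \<infinity>"
    "(\<integral>\<^sup>+ x. ennreal ((\<zeta> x * f x)\<^sup>2) / ennreal (product_density gs x) \<partial>lborel) < \<infinity>"
    "(\<integral>\<^sup>+ x. ennreal ((\<psi> x * f x)\<^sup>2) / ennreal (product_density gs x) \<partial>lborel) < \<infinity>"
    using A2[of f] A2[of "\<lambda>x. \<zeta> x * f x"] A2[of "\<lambda>x. \<psi> x * f x"] unfolding g by simp_all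
  have meas: "(\<lambda>x. \<zeta> x * f x) \<in> borel_measurable borel" "(\<lambda>x. \<psi> x * f x) \<in> borel_measurable borel"
    by measurable
  have sq: "square_integrable D.\<nu> u" "square_integrable D.\<nu> v" "square_integrable D.\<nu> w"
    unfolding u_def v_def w_def
    using D.square_integrable_quotient[OF _ A2'(1)] D.square_integrable_quotient[OF meas(1) A2'(2)]
      D.square_integrable_quotient[OF meas(2) A2'(3)] by simp_all

  \<comment> \<open>Here \<open>s I i\<close> is the squared probability times the conditional
    variance of a stratum, \<open>L I\<close> the limit for
    \<open>M \<rightarrow> \<infinity>\<close>, and \<open>l\<close> the real form of the final
    limit.\<close>
  define s where "s = (\<lambda>I i. (measure P (stratum_event P Y \<mu> gs I i))\<^sup>2 *
        cond_variance P (stratum_event P Y \<mu> gs I i) (\<lambda>\<omega>. \<phi> (Y \<omega>)))"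
  define L where "L = (\<lambda>I. \<Sum>i\<in>strata_indices I. s I i / measure D.\<nu> (stratum gs I i))"
  define l where "l = (\<integral>x. u x * v x - w x * w x \<partial>D.\<nu>)"
  have s0: "0 \<le> s I i" for I i unfolding s_def by (rule prob_square_cond_variance_nonneg)
  have L0: "0 \<le> L I" for I unfolding L_def using s0 by (intro sum_nonneg divide_nonneg_nonneg) auto
  have s_eq: "s I i = (LINT x:stratum gs I i|D.\<nu>. u x) * (LINT x:stratum gs I i|D.\<nu>. v x)
      - (LINT x:stratum gs I i|D.\<nu>. w x)\<^sup>2" for I i
  proof -
    have ev: "stratum_event P Y \<mu> gs I i = {\<omega> \<in> space P. X \<omega> \<in> stratum gs I i}"
      unfolding stratum_event_def X_def ..
    have "s I i = (LINT x:stratum gs I i|lborel. f x) * (LINT x:stratum gs I i|lborel. \<zeta> x * f x)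
      - (LINT x:stratum gs I i|lborel. \<psi> x * f x)\<^sup>2"
      unfolding s_def ev Z_def[symmetric]
      by (rule prob_square_cond_variance_given[OF X Z1 Z2 psi' zeta' fX f0 stratum_measurable])
    then show ?thesis
      unfolding u_def v_def w_def
        D.set_integral_quotient[OF meas(1) A2'(2) stratum_measurable]
        D.set_integral_quotient[OF meas(2) A2'(3) stratum_measurable]
        D.set_integral_quotient[OF \<open>f \<in> borel_measurable borel\<close> A2'(1) stratum_measurable] .
  qed
  \<comment> \<open>As a difference of two cell forms, \<open>L\<close> falls under the strong
    convergence of the projections.\<close>
  have "L = (\<lambda>I. cell_form D.\<nu> (strata_indices I) (stratum gs I) u v
      - cell_form D.\<nu> (strata_indices I) (stratum gs I) w w)"
    unfolding L_def s_eq cell_form_def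
    by (simp add: diff_divide_distrib sum_subtractf power2_eq_square)
  then have "L \<longlonglongrightarrow> (\<integral>x. u x * v x \<partial>D.\<nu>) - (\<integral>x. w x * w x \<partial>D.\<nu>)"
    using tendsto_diff[OF D.strata_form_tendsto[OF sq(1,2)] D.strata_form_tendsto[OF sq(3,3)]] by simp
  then have L_lim: "L \<longlonglongrightarrow> l"
    unfolding l_def using square_integrable_mult[OF sq(1,2)] square_integrable_mult[OF sq(3,3)] by simp
  have lv: "limit_variance f \<psi> \<zeta> chi = ennreal l"
    unfolding l_def u_def v_def w_def
  proof (rule limit_variance_eq)
    show "AE x in lborel. chi x = 0 \<longrightarrow> f x = 0"
      by (rule D.zero_if_chi_zero[OF _ A2'(1)]) simp
    show "AE x in lborel. 0 < f x \<longrightarrow> (\<psi> x)\<^sup>2 \<le> \<zeta> x"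
      by (rule cond_exp_given_square_le[OF X Z1 Z2 psi' zeta' fX]) simp
    show "integrable D.\<nu> (\<lambda>x. (f x / chi x) * (\<zeta> x * f x / chi x) - (\<psi> x * f x / chi x) * (\<psi> x * f x / chi x))"
      using square_integrable_mult[OF sq(1,2)] square_integrable_mult[OF sq(3,3)]
      unfolding u_def v_def w_def by (rule Bochner_Integration.integrable_diff)
  qed (use f0 chi0 in simp_all)

  define V where "V = (\<lambda>I M. real M * strat_variance P Y \<phi> r \<mu> gs (allocation gs chi) I M)"
  \<comment> \<open>The smallest expected count is at least \<open>c / e\<close>, so the relative
    error \<open>1 / (c / e - 1)\<close> becomes \<open>e / (c - e)\<close>.\<close>
  have err: "\<bar>V I M - L I\<bar> \<le> L I * (e / (c - e))"
    if e: "e = real I ^ CARD('m) / real M" "e < c" "I \<ge> 1" "M \<ge> 1" for I M e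
  proof -
    have e0: "e > 0" unfolding e(1) using that by simp
    have t: "real M * c / real I ^ CARD('m) = c / e" unfolding e(1) by simp
    have large: "1 < real M * c / real I ^ CARD('m)" unfolding t using e(2) e0 by simp
    have "1 / (c / e - 1) = e / (c - e)" using e(2) e0 by (simp add: field_simps)
    then show ?thesis
      using D.proportional_sum_error[where s = "s I", OF ord s0 large]
      unfolding V_def L_def s_def strat_variance_def t by simp
  qed
  have V_lim: "(\<lambda>M. V (IM M) M - L (IM M)) \<longlonglongrightarrow> 0"
    if IM: "\<And>M. M \<ge> 1 \<Longrightarrow> IM M \<ge> 1"
      and e: "(\<lambda>M. real (IM M) ^ CARD('m) / real M) \<longlonglongrightarrow> 0" for IM
  proof -
    define e where "e = (\<lambda>M. real (IM M) ^ CARD('m) / real M)"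
    have e_lim: "e \<longlonglongrightarrow> 0" using e unfolding e_def .
    \<comment> \<open>The error bound is relative to \<open>L (IM M)\<close>, and a convergent
      sequence is bounded, so the absolute error tends to 0 for fixed and for growing
      \<open>IM\<close> alike.\<close>
    obtain B where B: "\<And>I. \<bar>L I\<bar> \<le> B"
      using convergent_imp_Bseq[OF convergentI[OF L_lim]] unfolding Bseq_def by auto
    have ev: "\<forall>\<^sub>F M in sequentially. e M < c" using e_lim c(1) by (rule order_tendstoD(2))
    show ?thesis
    proof (rule Lim_null_comparison)
      show "\<forall>\<^sub>F M in sequentially. norm (V (IM M) M - L (IM M)) \<le> B * (e M / (c - e M))"
        using ev eventually_ge_at_top[of 1]
      proof eventually_elim
        case (elim M)
        have "0 \<le> e M / (c - e M)" using elim unfolding e_def by simp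
        then have "L (IM M) * (e M / (c - e M)) \<le> B * (e M / (c - e M))"
          using B[of "IM M"] by (intro mult_right_mono) auto
        then show ?case using err[OF _ elim(1) IM[OF elim(2)] elim(2)] unfolding e_def by simp
      qed
      have "(\<lambda>M. B * (e M / (c - e M))) \<longlonglongrightarrow> B * (0 / (c - 0))"
        using c(1) e_lim by (intro tendsto_intros) auto
      then show "(\<lambda>M. B * (e M / (c - e M))) \<longlonglongrightarrow> 0" by simp
    qed
  qed

  show ?thesis
  proof (intro conjI exI[of _ L] allI impI)
    fix I :: nat assume I: "I \<ge> 1"
    have "(\<lambda>M. real I ^ CARD('m) / real M) \<longlonglongrightarrow> 0"
      by (rule lim_const_over_n)
    then have "(\<lambda>M. V I M - L I) \<longlonglongrightarrow> 0" using V_lim[of "\<lambda>_. I"] I by simp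
    then have "(\<lambda>M. V I M) \<longlonglongrightarrow> L I" by (rule LIM_zero_cancel)
    then show "(\<lambda>M. real M * strat_variance P Y \<phi> r \<mu> gs (allocation gs chi) I M) \<longlonglongrightarrow> L I"
      unfolding V_def .
  next
    show "(\<lambda>I. ennreal (L I)) \<longlonglongrightarrow> limit_variance f \<psi> \<zeta> chi"
      unfolding lv using L_lim by (rule tendsto_ennrealI)
  next
    fix IM :: "nat \<Rightarrow> nat"
    assume "(\<forall>M\<ge>1. IM M \<ge> 1) \<and>
            (esssup D.\<nu> (\<lambda>x. ennreal (f x) / ennreal (chi x)) < \<infinity> \<and>
               (\<lambda>M. 1 / real (IM M) + real (IM M) ^ CARD('m) / real M) \<longlonglongrightarrow> 0
             \<or> (\<lambda>M. 1 / real (IM M) + real (IM M) ^ (2 * CARD('m)) / real M) \<longlonglongrightarrow> 0)"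
    \<comment> \<open>Either alternative supplies an exponent \<open>n \<ge> m\<close>, and since
      \<open>IM M \<ge> 1\<close> the rate with exponent \<open>n\<close> dominates the one with
      exponent \<open>m\<close>.\<close>
    then have IM: "\<And>M. M \<ge> 1 \<Longrightarrow> IM M \<ge> 1"
      and "\<exists>n\<ge>CARD('m). (\<lambda>M. 1 / real (IM M) + real (IM M) ^ n / real M) \<longlonglongrightarrow> 0"
      by (auto intro: exI[of _ "CARD('m)"] exI[of _ "2 * CARD('m)"])
    then obtain n where n: "n \<ge> CARD('m)"
      and lim: "(\<lambda>M. 1 / real (IM M) + real (IM M) ^ n / real M) \<longlonglongrightarrow> 0" by blast
    have "(\<lambda>M. real (IM M) ^ CARD('m) / real M) \<longlonglongrightarrow> 0"
    proof (rule Lim_null_comparison[OF _ lim])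
      show "\<forall>\<^sub>F M in sequentially. norm (real (IM M) ^ CARD('m) / real M) \<le> 1 / real (IM M) + real (IM M) ^ n / real M"
        using eventually_ge_at_top[of 1]
      proof eventually_elim
        case (elim M)
        have "real (IM M) ^ CARD('m) / real M \<le> real (IM M) ^ n / real M"
          using IM[OF elim] n by (intro divide_right_mono power_increasing) auto
        moreover have "0 \<le> 1 / real (IM M)" "0 \<le> real (IM M) ^ CARD('m) / real M" by simp_all
        ultimately show ?case unfolding real_norm_def by linarith
      qed
    qed
    then have "(\<lambda>M. V (IM M) M - L (IM M)) \<longlonglongrightarrow> 0" using V_lim[of IM] IM by blast
    moreover have "(\<lambda>M. L (IM M)) \<longlonglongrightarrow> l"
    proof (rule filterlim_compose[OF L_lim])
      \<comment> \<open>The first summand of the rate forces \<open>IM M\<close> to infinity, so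
        \<open>L\<close> converges along the sequence.\<close>
      have "(\<lambda>M. inverse (real (IM M))) \<longlonglongrightarrow> 0"
        by (rule Lim_null_comparison[OF _ lim]) (simp add: inverse_eq_divide)
      moreover have "\<forall>\<^sub>F M in sequentially. 0 < inverse (real (IM M))"
        using eventually_ge_at_top[of 1] by eventually_elim (use IM in force)
      ultimately have "filterlim (\<lambda>M. inverse (inverse (real (IM M)))) at_top sequentially"
        by (rule filterlim_inverse_at_top)
      then show "filterlim IM at_top sequentially"
        by (simp add: filterlim_sequentially_iff_filterlim_real)
    qed
    ultimately have "(\<lambda>M. (V (IM M) M - L (IM M)) + L (IM M)) \<longlonglongrightarrow> 0 + l" by (rule tendsto_add)
    then have "(\<lambda>M. V (IM M) M) \<longlonglongrightarrow> l" by simp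
    then show "(\<lambda>M. ennreal (real M * strat_variance P Y \<phi> r \<mu> gs (allocation gs chi) (IM M) M))
        \<longlonglongrightarrow> limit_variance f \<psi> \<zeta> chi"
      unfolding lv V_def by (rule tendsto_ennrealI)
  qed
qed

end
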